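(* Let $d\geq 1$ and let $D$ be an oriented graph with no directed triangle, of minimum semi-degree $d$ and of order $n=md$ with $m\leq 3$. Then every vertex $x$ of $D$ is contained in more than $$\dfrac{2(5-m-4c+c^2)d}{(1-c)(2-c)}+(2-m)d+1$$ directed cycles such that any two of these cycles have only the vertex $x$ in common.
   Context: Digraphs have no loops and no parallel arcs. An oriented graph is a digraph in which for any two distinct vertices $x,y$ at most one of $(x,y),(y,x)$ is an arc. The minimum semi-degree of $D$ is the minimum of its minimum out-degree and its minimum in-degree. A directed triangle is a directed cycle of length $3$. The constant $c$ denotes the minimum constant such that every digraph of order $n$ with minimum out-degree at least $cn$ contains a directed cycle of length at most $3$; it is known that $\frac13\leq c\leq 0.3465$. *)

theory Defs
  imports Complex_Main "Graph_Theory.Graph_Theory"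
begin

definition min_out_degree :: "('a, 'b) pre_digraph \<Rightarrow> nat" where
  "min_out_degree G = Min (out_degree G ` verts G)"

definition min_in_degree :: "('a, 'b) pre_digraph \<Rightarrow> nat" where
  "min_in_degree G = Min (in_degree G ` verts G)"

definition min_semi_degree :: "('a, 'b) pre_digraph \<Rightarrow> nat" where
  "min_semi_degree G = min (min_out_degree G) (min_in_degree G)"

locale oriented_graph = digraph +
  assumes at_most_one_arc:
    "\<lbrakk>x \<in> verts G; y \<in> verts G; x \<noteq> y\<rbrakk> \<Longrightarrow> \<not> (x \<rightarrow>\<^bsub>G\<^esub> y \<and> y \<rightarrow>\<^bsub>G\<^esub> x)"

definition has_directed_triangle :: "('a, 'b) pre_digraph \<Rightarrow> bool" where
  "has_directed_triangle G \<longleftrightarrow> (\<exists>p. pre_digraph.cycle G p \<and> length p = 3)"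

definition cycle_verts :: "('a, 'b) pre_digraph \<Rightarrow> 'b list \<Rightarrow> 'a set" where
  "cycle_verts G p = tail G ` set p"

text \<open>
  Every finite digraph without parallel arcs is isomorphic to one of type
  \<^typ>\<open>(nat, nat \<times> nat) pre_digraph\<close>, so fixing this type loses no generality.
  The null graph has no minimum out-degree and is excluded.
\<close>

definition forces_short_cycle :: "real \<Rightarrow> bool" where
  "forces_short_cycle c \<longleftrightarrow>
    (\<forall>G :: (nat, nat \<times> nat) pre_digraph.
       digraph G \<longrightarrow> verts G \<noteq> {} \<longrightarrow>
       c * real (card (verts G)) \<le> real (min_out_degree G) \<longrightarrow>
       (\<exists>p. pre_digraph.cycle G p \<and> length p \<le> 3))"

definition short_cycle_const :: real where
  "short_cycle_const = (LEAST c. forces_short_cycle c)"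

text \<open>
  The minimum is attained: if a digraph of order n with minimum out-degree k > 0 has no short
  cycle, then neither has its lexicographic square, whose ratio of minimum out-degree to order
  is (k n + k) / n^2 > k / n.
\<close>

definition rel_short_cycle :: "'v rel \<Rightarrow> bool" where
  "rel_short_cycle R \<longleftrightarrow> (\<exists>u. (u, u) \<in> R) \<or> (\<exists>u v. (u, v) \<in> R \<and> (v, u) \<in> R) \<or>
     (\<exists>u v w. (u, v) \<in> R \<and> (v, w) \<in> R \<and> (w, u) \<in> R)"

lemma rel_short_cycleE:
  assumes "rel_short_cycle R"
  obtains u where "(u, u) \<in> R" | u v where "(u, v) \<in> R" "(v, u) \<in> R"
    | u v w where "(u, v) \<in> R" "(v, w) \<in> R" "(w, u) \<in> R"
  using assms unfolding rel_short_cycle_def by blast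

lemma (in wf_digraph) short_cycle_imp_rel:
  assumes "cycle p" "length p \<le> 3"
  shows "rel_short_cycle (arcs_ends G)"
proof -
  obtain u where p: "awalk u p u" "p \<noteq> []"
    using assms(1) by (auto simp: cycle_def)
  have dom: "(tail G e, head G e) \<in> arcs_ends G" if "e \<in> arcs G" for e
    using that by (auto simp: arcs_ends_conv)
  have "length p = 1 \<or> length p = 2 \<or> length p = 3"
    using p(2) assms(2) by (cases p) (auto simp: le_Suc_eq numeral_eq_Suc)
  then consider a where "p = [a]" | a b where "p = [a, b]" | a b c where "p = [a, b, c]"
    by (auto simp: length_Suc_conv numeral_eq_Suc)
  then show ?thesis
  proof cases
    case 1
    then show ?thesis using p(1) dom[of a] by (auto simp: rel_short_cycle_def awalk_def)
  next
    case 2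
    then have "head G a = tail G b" "head G b = tail G a" "a \<in> arcs G" "b \<in> arcs G"
      using p(1) by (auto simp: awalk_def)
    then show ?thesis
      using dom[of a] dom[of b] unfolding rel_short_cycle_def by metis
  next
    case 3
    then have "head G a = tail G b" "head G b = tail G c" "head G c = tail G a"
      "a \<in> arcs G" "b \<in> arcs G" "c \<in> arcs G"
      using p(1) by (auto simp: awalk_def)
    then show ?thesis
      using dom[of a] dom[of b] dom[of c] unfolding rel_short_cycle_def by metis
  qed
qed

lemma (in loopfree_digraph) rel_imp_short_cycle:
  assumes "rel_short_cycle (arcs_ends G)"
  shows "\<exists>p. cycle p \<and> length p \<le> 3"
proof -
  have nl: "(u, u) \<notin> arcs_ends G" for u
    using adj_not_same by blast
  from assms nl consider
      u v where "(u, v) \<in> arcs_ends G" "(v, u) \<in> arcs_ends G"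
    | u v w where "(u, v) \<in> arcs_ends G" "(v, w) \<in> arcs_ends G" "(w, u) \<in> arcs_ends G"
    unfolding rel_short_cycle_def by blast
  then show ?thesis
  proof cases
    case (1 u v)
    from 1(1) obtain e where e: "e \<in> arcs G" "tail G e = u" "head G e = v" by (rule reachableE)
    from 1(2) obtain f where f: "f \<in> arcs G" "tail G f = v" "head G f = u" by (rule reachableE)
    have "u \<noteq> v" using 1 nl by metis
    then have "cycle [e, f]"
      unfolding cycle_def awalk_def using e f by (intro exI[of _ u]) auto
    then show ?thesis by (intro exI[of _ "[e, f]"]) simp
  next
    case (2 u v w)
    from 2(1) obtain e where e: "e \<in> arcs G" "tail G e = u" "head G e = v" by (rule reachableE)
    from 2(2) obtain f where f: "f \<in> arcs G" "tail G f = v" "head G f = w" by (rule reachableE)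
    from 2(3) obtain g where g: "g \<in> arcs G" "tail G g = w" "head G g = u" by (rule reachableE)
    have "u \<noteq> v" "v \<noteq> w" "w \<noteq> u" using 2 nl by metis+
    then have "cycle [e, f, g]"
      unfolding cycle_def awalk_def using e f g by (intro exI[of _ u]) auto
    then show ?thesis by (intro exI[of _ "[e, f, g]"]) simp
  qed
qed

lemma forces_short_cycle_rel:
  fixes V :: "'v set"
  assumes c: "forces_short_cycle c" and V: "finite V" "V \<noteq> {}" and R: "R \<subseteq> V \<times> V"
    and deg: "\<And>v. v \<in> V \<Longrightarrow> c * real (card V) \<le> real (card (R `` {v}))"
  shows "rel_short_cycle R"
proof (rule ccontr)
  assume no: "\<not> rel_short_cycle R"
  obtain f :: "'v \<Rightarrow> nat" where f: "inj_on f V"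
    using finite_imp_inj_to_nat_seg[OF V(1)] by blast
  define G where "G = \<lparr>verts = f ` V, arcs = map_prod f f ` R, tail = fst, head = snd\<rparr>"
  have sel: "verts G = f ` V" "arcs G = map_prod f f ` R" "tail G = fst" "head G = snd"
    by (simp_all add: G_def)
  have finR: "finite R" using R V(1) finite_subset by blast
  have ends: "arcs_ends G = map_prod f f ` R"
    by (auto simp: arcs_ends_conv sel image_image case_prod_beta map_prod_def)
  have refl_f: "(f u, f v) \<in> map_prod f f ` R \<longleftrightarrow> (u, v) \<in> R" if "u \<in> V" "v \<in> V" for u v
  proof
    assume "(f u, f v) \<in> map_prod f f ` R"
    then obtain a b where ab: "(a, b) \<in> R" "f u = f a" "f v = f b" by auto
    then have "u = a" "v = b" using R that f by (auto dest: inj_onD)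
    then show "(u, v) \<in> R" using ab by simp
  next
    assume "(u, v) \<in> R"
    then show "(f u, f v) \<in> map_prod f f ` R" by (rule map_prod_imageI)
  qed
  have img: "\<exists>u\<in>V. \<exists>v\<in>V. x = f u \<and> y = f v \<and> (u, v) \<in> R" if "(x, y) \<in> map_prod f f ` R" for x y
  proof -
    from that obtain u v where uv: "(u, v) \<in> R" "x = f u" "y = f v" by auto
    moreover have "u \<in> V" "v \<in> V" using uv(1) R by auto
    ultimately show ?thesis by blast
  qed
  have noG: "\<not> rel_short_cycle (arcs_ends G)"
  proof
    assume *: "rel_short_cycle (arcs_ends G)"
    have "rel_short_cycle R"
      using *[unfolded ends]
    proof (cases rule: rel_short_cycleE)
      case (1 x)
      from img[OF 1] obtain u where "u \<in> V" "x = f u" by blast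
      then have "(u, u) \<in> R" using refl_f[of u u] 1 by simp
      then show ?thesis unfolding rel_short_cycle_def by blast
    next
      case (2 x y)
      from img[OF 2(1)] obtain u v where uv: "u \<in> V" "v \<in> V" "x = f u" "y = f v" "(u, v) \<in> R"
        by blast
      then have "(v, u) \<in> R" using refl_f[of v u] 2 by simp
      then show ?thesis using uv unfolding rel_short_cycle_def by blast
    next
      case (3 x y z)
      from img[OF 3(1)] obtain u v where uv: "u \<in> V" "v \<in> V" "x = f u" "y = f v" "(u, v) \<in> R"
        by blast
      from img[OF 3(2)] obtain w where w: "w \<in> V" "z = f w" by blast
      have "(v, w) \<in> R" "(w, u) \<in> R"
        using refl_f[of v w] refl_f[of w u] 3 uv w by simp_all
      then show ?thesis using uv unfolding rel_short_cycle_def by blast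
    qed
    then show False using no by simp
  qed
  have wf: "wf_digraph G"
    using R by unfold_locales (auto simp: sel)
  have loops: "(x, x) \<notin> map_prod f f ` R" for x
    using noG unfolding ends[symmetric] rel_short_cycle_def by blast
  have "digraph G"
  proof -
    interpret wf_digraph G by (rule wf)
    show ?thesis
    proof unfold_locales
      show "finite (verts G)" "finite (arcs G)" using V finR by (simp_all add: sel)
      show "tail G e \<noteq> head G e" if "e \<in> arcs G" for e
        using that loops[of "fst e"] unfolding sel by (metis prod.collapse)
      show "e1 = e2" if "e1 \<in> arcs G" "e2 \<in> arcs G" "arc_to_ends G e1 = arc_to_ends G e2" for e1 e2
        using that by (simp add: arc_to_ends_def sel prod_eq_iff)
    qed
  qed
  then interpret digraph G .
  have od: "out_degree G (f v) = card (R `` {v})" if v: "v \<in> V" for v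
  proof -
    have "out_arcs G (f v) = (\<lambda>w. (f v, f w)) ` (R `` {v})"
    proof (intro set_eqI iffI)
      fix e assume "e \<in> out_arcs G (f v)"
      then have e: "e \<in> map_prod f f ` R" "fst e = f v" by (auto simp: sel)
      then obtain a b where ab: "(a, b) \<in> R" "e = (f a, f b)" by auto
      then have "a = v" using e R v f by (auto dest: inj_onD)
      then show "e \<in> (\<lambda>w. (f v, f w)) ` (R `` {v})" using ab by auto
    next
      fix e assume "e \<in> (\<lambda>w. (f v, f w)) ` (R `` {v})"
      then show "e \<in> out_arcs G (f v)" by (force simp: sel)
    qed
    moreover have "inj_on (\<lambda>w. (f v, f w)) (R `` {v})"
      using f R by (auto simp: inj_on_def)
    ultimately show ?thesis by (simp add: out_degree_def card_image)
  qed
  have "min_out_degree G \<in> out_degree G ` verts G"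
    unfolding min_out_degree_def using V by (intro Min_in) (auto simp: sel)
  then obtain v where v: "v \<in> V" "min_out_degree G = out_degree G (f v)" by (auto simp: sel)
  have "c * real (card (verts G)) \<le> real (min_out_degree G)"
    using deg[OF v(1)] v od by (simp add: sel card_image f)
  moreover have "verts G \<noteq> {}" using V by (simp add: sel)
  ultimately obtain p where "cycle p" "length p \<le> 3"
    using c \<open>digraph G\<close> unfolding forces_short_cycle_def by blast
  then show False using short_cycle_imp_rel noG by blast
qed

lemma not_forces_short_cycleE:
  assumes "\<not> forces_short_cycle c"
  obtains V :: "nat set" and R k where "finite V" "V \<noteq> {}" "R \<subseteq> V \<times> V" "\<not> rel_short_cycle R"
    "c * real (card V) \<le> real k" "\<And>v. v \<in> V \<Longrightarrow> k \<le> card (R `` {v})"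
proof -
  obtain G :: "(nat, nat \<times> nat) pre_digraph" where G: "digraph G" "verts G \<noteq> {}"
    "c * real (card (verts G)) \<le> real (min_out_degree G)"
    "\<not> (\<exists>p. pre_digraph.cycle G p \<and> length p \<le> 3)"
    using assms unfolding forces_short_cycle_def by blast
  interpret digraph G by (rule G)
  show ?thesis
  proof
    show "finite (verts G)" "verts G \<noteq> {}" using G by simp_all
    show "arcs_ends G \<subseteq> verts G \<times> verts G" by (auto simp: arcs_ends_conv)
    show "\<not> rel_short_cycle (arcs_ends G)" using rel_imp_short_cycle G(4) by blast
    show "c * real (card (verts G)) \<le> real (min_out_degree G)" by (rule G)
    fix v assume v: "v \<in> verts G"
    have "min_out_degree G \<le> out_degree G v"
      unfolding min_out_degree_def using v by (intro Min_le) auto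
    also have "out_degree G v \<le> card (arcs_ends G `` {v})"
    proof -
      have inj: "inj_on (head G) (out_arcs G v)"
        by (rule inj_onI, rule no_multi_arcs) (simp_all add: arc_to_ends_def)
      have "head G ` out_arcs G v \<subseteq> arcs_ends G `` {v}"
        by (auto simp: arcs_ends_conv)
      moreover have "finite (arcs_ends G `` {v})" by (auto simp: arcs_ends_conv intro: finite_Image)
      ultimately show ?thesis
        unfolding out_degree_def by (metis inj card_image card_mono)
    qed
    finally show "min_out_degree G \<le> card (arcs_ends G `` {v})" .
  qed
qed

lemma forces_short_cycle_mono:
  assumes "forces_short_cycle c" "c \<le> c'" shows "forces_short_cycle c'"
  unfolding forces_short_cycle_def
proof (intro allI impI)
  fix G :: "(nat, nat \<times> nat) pre_digraph"
  assume G: "digraph G" "verts G \<noteq> {}" "c' * real (card (verts G)) \<le> real (min_out_degree G)"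
  have "c * real (card (verts G)) \<le> c' * real (card (verts G))"
    using assms(2) by (rule mult_right_mono) simp
  then show "\<exists>p. pre_digraph.cycle G p \<and> length p \<le> 3"
    using assms(1) G unfolding forces_short_cycle_def by auto
qed

lemma forces_short_cycle_1: "forces_short_cycle 1"
proof (rule ccontr)
  assume "\<not> forces_short_cycle 1"
  then obtain V :: "nat set" and R k where *: "finite V" "V \<noteq> {}" "R \<subseteq> V \<times> V"
    "\<not> rel_short_cycle R" "1 * real (card V) \<le> real k" "\<And>v. v \<in> V \<Longrightarrow> k \<le> card (R `` {v})"
    by (rule not_forces_short_cycleE) blast
  obtain v where v: "v \<in> V" using * by blast
  have "R `` {v} \<subseteq> V - {v}" using * by (auto simp: rel_short_cycle_def)
  then have "card (R `` {v}) \<le> card (V - {v})" using * by (intro card_mono) auto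
  also have "\<dots> < card V" using * v by (intro psubset_card_mono) auto
  finally show False using *(5) *(6)[OF v] by simp
qed

lemma rel_4_cycle: "\<not> rel_short_cycle {(0::nat, 1), (1, 2), (2, 3), (3, 0::nat)}"
proof -
  have R: "(u, v) \<in> {(0::nat, 1), (1, 2), (2, 3), (3, 0::nat)} \<Longrightarrow> u < 4 \<and> v = (u + 1) mod 4" for u v
    by auto
  show ?thesis
  proof
    assume "rel_short_cycle {(0::nat, 1), (1, 2), (2, 3), (3, 0::nat)}"
    then show False
      by (cases rule: rel_short_cycleE) (drule R, presburger | (drule R)+, presburger)+
  qed
qed

lemma forces_short_cycle_ge:
  assumes "forces_short_cycle c" shows "1 / 4 \<le> c"
proof (rule ccontr)
  assume "\<not> 1 / 4 \<le> c"
  then have "forces_short_cycle (1 / 4)" using forces_short_cycle_mono[OF assms] by simp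
  then have "rel_short_cycle {(0::nat, 1), (1, 2), (2, 3), (3, 0::nat)}"
  proof (rule forces_short_cycle_rel[where V = "{0, 1, 2, 3}"])
    fix v :: nat assume "v \<in> {0, 1, 2, 3}"
    then have "{(0::nat, 1), (1, 2), (2, 3), (3, 0::nat)} `` {v} = {(v + 1) mod 4}" by auto
    then show "1 / 4 * real (card {0::nat, 1, 2, 3}) \<le>
      real (card ({(0::nat, 1), (1, 2), (2, 3), (3, 0::nat)} `` {v}))" by simp
  qed auto
  then show False using rel_4_cycle by contradiction
qed

lemma forces_short_cycle_Inf: "forces_short_cycle (Inf {c. forces_short_cycle c})"
proof (rule ccontr)
  define c0 where "c0 = Inf {c. forces_short_cycle c}"
  assume "\<not> forces_short_cycle (Inf {c. forces_short_cycle c})"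
  then have "\<not> forces_short_cycle c0" by (simp add: c0_def)
  then obtain V :: "nat set" and R k where *: "finite V" "V \<noteq> {}" "R \<subseteq> V \<times> V"
    "\<not> rel_short_cycle R" "c0 * real (card V) \<le> real k" "\<And>v. v \<in> V \<Longrightarrow> k \<le> card (R `` {v})"
    by (rule not_forces_short_cycleE) blast
  have ne: "{c. forces_short_cycle c} \<noteq> {}" using forces_short_cycle_1 by blast
  have c0: "1 / 4 \<le> c0"
    unfolding c0_def using ne forces_short_cycle_ge by (intro cInf_greatest) auto
  define n where "n = card V"
  have n: "n > 0" using * by (simp add: n_def card_gt_0_iff)
  have "0 < c0 * real n" using c0 n by simp
  then have k: "k > 0" using *(5) by (simp add: n_def)
  define W where "W = V \<times> V"
  define Q where "Q = {((a, b), (a', b')) | a b a' b'.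
      b \<in> V \<and> b' \<in> V \<and> (a, a') \<in> R \<or> a \<in> V \<and> a' = a \<and> (b, b') \<in> R}"
  define c1 where "c1 = (real k * real n + real k) / (real n * real n)"
  have Q: "Q \<subseteq> W \<times> W" using *(3) by (auto simp: Q_def W_def)
  have irr: "(a, a) \<notin> R" for a
    using *(4) unfolding rel_short_cycle_def by blast
  have asym: "(a, b) \<in> R \<Longrightarrow> (b, a) \<notin> R" for a b
    using *(4) unfolding rel_short_cycle_def by blast
  have tri: "(a, b) \<in> R \<Longrightarrow> (b, d) \<in> R \<Longrightarrow> (d, a) \<notin> R" for a b d
    using *(4) unfolding rel_short_cycle_def by blast
  have noQ: "\<not> rel_short_cycle Q"
  proof
    have step: "(fst p, fst q) \<in> R \<or> fst p = fst q \<and> (snd p, snd q) \<in> R" if "(p, q) \<in> Q" for p q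
      using that by (auto simp: Q_def)
    assume "rel_short_cycle Q"
    then consider p where "(p, p) \<in> Q" | p q where "(p, q) \<in> Q" "(q, p) \<in> Q"
      | p q r where "(p, q) \<in> Q" "(q, r) \<in> Q" "(r, p) \<in> Q"
      unfolding rel_short_cycle_def by blast
    then show False
    proof cases
      case 1
      then show ?thesis using step[OF 1] irr by auto
    next
      case 2
      then show ?thesis using step[OF 2(1)] step[OF 2(2)] irr asym by metis
    next
      case 3
      then show ?thesis
        using step[OF 3(1)] step[OF 3(2)] step[OF 3(3)] irr asym tri by metis
    qed
  qed
  have deg: "k * n + k \<le> card (Q `` {w})" if w: "w \<in> W" for w
  proof -
    obtain a b where ab: "w = (a, b)" "a \<in> V" "b \<in> V" using w by (auto simp: W_def)
    have fin: "finite (R `` {v})" for v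
      using *(1,3) by (meson finite_Image finite_SigmaI finite_subset)
    have eq: "Q `` {w} = (R `` {a}) \<times> V \<union> {a} \<times> (R `` {b})"
      using ab by (auto simp: Q_def)
    have "card (Q `` {w}) = card (R `` {a}) * n + card (R `` {b})"
      unfolding eq using fin *(1) irr
      by (subst card_Un_disjoint) (auto simp: n_def card_cartesian_product)
    then show ?thesis using *(6)[OF ab(2)] *(6)[OF ab(3)] by (simp add: add_mono)
  qed
  have nf: "\<not> forces_short_cycle c1"
  proof
    assume "forces_short_cycle c1"
    then have "rel_short_cycle Q"
    proof (rule forces_short_cycle_rel[where V = W])
      show "finite W" "W \<noteq> {}" "Q \<subseteq> W \<times> W" using * Q by (auto simp: W_def)
      fix w assume "w \<in> W"
      have "c1 * real (card W) = real (k * n + k)"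
        using n by (simp add: c1_def W_def card_cartesian_product n_def[symmetric])
      then show "c1 * real (card W) \<le> real (card (Q `` {w}))"
        using deg[OF \<open>w \<in> W\<close>] by linarith
    qed
    then show False using noQ by contradiction
  qed
  have "c1 \<le> c0"
    unfolding c0_def
  proof (rule cInf_greatest[OF ne])
    fix c assume "c \<in> {c. forces_short_cycle c}"
    then show "c1 \<le> c" using nf forces_short_cycle_mono[of c c1] by (cases "c1 \<le> c") auto
  qed
  then have "c1 * (real n * real n) \<le> c0 * real n * real n"
    by (simp add: mult.assoc mult_right_mono)
  also have "\<dots> \<le> real k * real n" using *(5) by (simp add: n_def mult_right_mono)
  finally show False using n k by (simp add: c1_def)
qed

theorem short_cycle_const_minimum:
  shows "forces_short_cycle short_cycle_const"
    and "forces_short_cycle c \<Longrightarrow> short_cycle_const \<le> c"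
proof -
  have lower: "Inf {c. forces_short_cycle c} \<le> c" if "forces_short_cycle c" for c
    using that forces_short_cycle_ge by (intro cInf_lower bdd_belowI[of _ "1 / 4"]) auto
  have eq: "short_cycle_const = Inf {c. forces_short_cycle c}"
    unfolding short_cycle_const_def
    using forces_short_cycle_Inf lower by (rule Least_equality)
  show "forces_short_cycle short_cycle_const"
    unfolding eq by (rule forces_short_cycle_Inf)
  show "short_cycle_const \<le> c" if "forces_short_cycle c"
    unfolding eq by (rule lower[OF that])
qed

end

theory Submission
  imports Defs
begin

text \<open>
  By Menger's theorem it suffices to bound the size k of a set S separating the out-neighbours of x
  from its in-neighbours in D - x. Such a set splits the remaining vertices into A and B without
  arcs from A to B. The constant c is used only in the form: every set U of vertices contains a
  vertex with fewer than c |U| out-neighbours (or in-neighbours) in U. Two facts then collide.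

  First, in a digraph without short cycles every arc (u, v) satisfies
  |N-(u) \<inter> N-(v)| \<ge> s + (1 - c) |N+(u) \<inter> N+(v)| with s = 3 d + 1 - n, and symmetrically; so both
  numbers are at least s / c, whence s < c^2 d.

  Secondly, let A be the smaller side, choose y in A with few out-neighbours in A, z in S \<inter> N+(y)
  with few out-neighbours in S \<inter> N+(y), and w in A \<inter> N+(y) with few out-neighbours in A \<inter> N+(y).
  If no arc leads from z back to A, then N-(y), N+(z), (S \<inter> N+(y)) - N+(z) and A - N-(y) are disjoint,
  and w shows that the last one is large; this gives n > (3 - c) d + 1 + (d - k), that is
  (d - k) + s < c d. A vertex of S with arcs back to A has very many of them, so S contains
  only few such vertices and z can be chosen to avoid them.
\<close>

section \<open>Menger's theorem for digraphs\<close>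

text \<open>Walks are vertex lists, so arc names stay out of the argument. A one-element list with
  its vertex in A \<inter> B counts as a walk; the base case of Menger's theorem consists of
  these.\<close>

definition walk_between :: "'a rel \<Rightarrow> 'a set \<Rightarrow> 'a set \<Rightarrow> 'a list \<Rightarrow> bool" where
  "walk_between R A B p \<longleftrightarrow>
     p \<noteq> [] \<and> hd p \<in> A \<and> last p \<in> B \<and> successively (\<lambda>u v. (u, v) \<in> R) p"

definition separates :: "'a rel \<Rightarrow> 'a set \<Rightarrow> 'a set \<Rightarrow> 'a set \<Rightarrow> bool" where
  "separates R A B S \<longleftrightarrow> (\<forall>p. walk_between R A B p \<longrightarrow> set p \<inter> S \<noteq> {})"

definition disjoint_paths :: "'a rel \<Rightarrow> 'a set \<Rightarrow> 'a set \<Rightarrow> 'a list set \<Rightarrow> bool" where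
  "disjoint_paths R A B P \<longleftrightarrow>
     (\<forall>p\<in>P. walk_between R A B p \<and> distinct p) \<and> pairwise (\<lambda>p q. set p \<inter> set q = {}) P"

lemma separatesD: "separates R A B S \<Longrightarrow> walk_between R A B p \<Longrightarrow> \<exists>v\<in>set p. v \<in> S"
  by (auto simp: separates_def)

lemma walk_between_mono:
  assumes "walk_between R A B p" "R \<subseteq> R'"
  shows "walk_between R' A B p"
  using assms unfolding walk_between_def by (auto elim: successively_mono)

lemma disjoint_paths_mono:
  assumes "disjoint_paths R A B P" "R \<subseteq> R'"
  shows "disjoint_paths R' A B P"
  using assms walk_between_mono[of R A B _ R'] unfolding disjoint_paths_def by auto

text \<open>A list that uses the arc (x, y) has x before its last position and y after its first
  one.\<close>

lemma successively_Diff_edge: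
  assumes "successively (\<lambda>u v. (u, v) \<in> R) p" "x \<notin> set (butlast p) \<or> y \<notin> set (tl p)"
  shows "successively (\<lambda>u v. (u, v) \<in> R - {(x, y)}) p"
  using assms
proof (induction p)
  case (Cons a p)
  then show ?case
    by (cases p; cases "tl p") (auto simp: successively_Cons)
qed simp

lemma walk_between_split:
  assumes "walk_between R A B (p @ v # q)"
  shows "walk_between R A {v} (p @ [v])" "walk_between R {v} B (v # q)"
  using assms by (auto simp: walk_between_def successively_append_iff hd_append successively_Cons
      split: if_splits)

lemma walk_between_join:
  assumes "walk_between R A {v} (p @ [v])" "walk_between R {v} B (v # q)"
  shows "walk_between R A B (p @ v # q)"
  using assms by (auto simp: walk_between_def successively_append_iff hd_append successively_Cons
      split: if_splits)

text \<open>Disjointness makes \<open>last\<close> injective on P, hence by the count a bijection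
  onto T. Every vertex of T is then the end of some path, and any path through it must be that
  path.\<close>

lemma disjoint_paths_last:
  assumes P: "disjoint_paths R A T P" and fin: "finite T" and card: "card P = card T" "card P > 0"
  shows "bij_betw last P T" and "p \<in> P \<Longrightarrow> set p \<inter> T = {last p}"
proof -
  have last: "last p \<in> T" "last p \<in> set p" if "p \<in> P" for p
    using P that unfolding disjoint_paths_def walk_between_def by auto
  have inj: "inj_on last P"
  proof (rule inj_onI)
    fix p q assume "p \<in> P" "q \<in> P" "last p = last q"
    then have "set p \<inter> set q \<noteq> {}" using last by (metis disjoint_iff)
    then show "p = q" using P \<open>p \<in> P\<close> \<open>q \<in> P\<close> unfolding disjoint_paths_def pairwise_def by blast
  qed
  have "last ` P = T"
    using card last inj by (intro card_subset_eq[OF fin]) (auto simp: card_image)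
  with inj show bij: "bij_betw last P T" by (simp add: bij_betw_def)
  assume p: "p \<in> P"
  have "v = last p" if v: "v \<in> set p" "v \<in> T" for v
  proof -
    obtain q where q: "q \<in> P" "v = last q" using bij v(2) by (auto simp: bij_betw_def)
    have "set p \<inter> set q \<noteq> {}" using last(2)[OF q(1)] q(2) v(1) by blast
    then have "p = q" using P p q(1) unfolding disjoint_paths_def pairwise_def by blast
    then show ?thesis using q(2) by simp
  qed
  then show "set p \<inter> T = {last p}" using last[OF p] by blast
qed

lemma walk_between_rev: "walk_between (R\<inverse>) B A (rev p) \<longleftrightarrow> walk_between R A B p"
  by (auto simp: walk_between_def hd_rev last_rev)

lemma disjoint_paths_rev: "disjoint_paths (R\<inverse>) B A (rev ` P) \<longleftrightarrow> disjoint_paths R A B P"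
  by (auto simp: disjoint_paths_def walk_between_rev pairwise_def)

lemma disjoint_paths_hd:
  assumes "disjoint_paths R T B P" "finite T" "card P = card T" "card P > 0"
  shows "bij_betw hd P T" and "p \<in> P \<Longrightarrow> set p \<inter> T = {hd p}"
proof -
  have *: "disjoint_paths (R\<inverse>) B T (rev ` P)" using assms by (simp add: disjoint_paths_rev)
  have card: "card (rev ` P) = card T" "card (rev ` P) > 0"
    using assms by (simp_all add: card_image)
  have "bij_betw (last \<circ> rev) P T"
    using disjoint_paths_last(1)[OF * assms(2) card]
    by (auto intro: bij_betw_trans inj_on_imp_bij_betw)
  moreover have ne: "q \<noteq> []" if "q \<in> P" for q
    using assms(1) that by (auto simp: disjoint_paths_def walk_between_def)
  ultimately show "bij_betw hd P T"
    by (subst bij_betw_cong[of _ _ "last \<circ> rev"]) (auto simp: last_rev)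
  show "set p \<inter> T = {hd p}" if "p \<in> P"
    using disjoint_paths_last(2)[OF * assms(2) card, of "rev p"] that ne[OF that]
    by (simp add: last_rev)
qed

lemma in_set_tlD: "a \<in> set (tl xs) \<Longrightarrow> a \<in> set xs"
  by (cases xs) auto

text \<open>Goering's proof: delete an edge (x, y). A separator Z that became too small is completed by
  x and by y to separators of the full size, and the two linkages to Z + x and from Z + y that the
  induction provides meet only in Z.\<close>

theorem menger:
  assumes "finite R" "finite A" "\<And>S. finite S \<Longrightarrow> separates R A B S \<Longrightarrow> s \<le> card S"
  shows "\<exists>P. disjoint_paths R A B P \<and> finite P \<and> card P = s"
  using assms
proof (induction "card R" arbitrary: R A B s rule: less_induct)
  case less
  show ?case
  proof (cases "R = {}")
    case True
    have "separates R A B (A \<inter> B)"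
      unfolding separates_def
    proof (intro allI impI)
      fix p assume "walk_between R A B p"
      then have "p = [hd p]" "hd p \<in> A" "last p \<in> B"
        using True by (cases p; cases "tl p"; auto simp: walk_between_def)+
      then show "set p \<inter> (A \<inter> B) \<noteq> {}"
        by (metis IntI empty_iff last.simps list.set_intros(1))
    qed
    then have "s \<le> card (A \<inter> B)" using less.prems by simp
    then obtain C where C: "C \<subseteq> A \<inter> B" "card C = s" "finite C"
      using less.prems(2) by (meson finite_Int obtain_subset_with_card_n)
    have "disjoint_paths R A B ((\<lambda>v. [v]) ` C)"
      using C by (auto simp: disjoint_paths_def walk_between_def pairwise_def)
    moreover have "card ((\<lambda>v. [v]) ` C) = s"
      using C by (subst card_image) (auto simp: inj_on_def)
    ultimately show ?thesis using C by blast
  next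
    case False
    then obtain x y where e: "(x, y) \<in> R" by auto
    define R' where "R' = R - {(x, y)}"
    have R': "finite R'" "card R' < card R" "R' \<subseteq> R"
      using less.prems(1) e card_Diff1_less[of R "(x, y)"] by (auto simp only: R'_def finite_Diff)
    show ?thesis
    proof (cases "\<forall>S. finite S \<longrightarrow> separates R' A B S \<longrightarrow> s \<le> card S")
      case True
      then have "\<exists>P. disjoint_paths R' A B P \<and> finite P \<and> card P = s"
        by (intro less.hyps[OF R'(2,1) less.prems(2)]) simp
      then obtain P where "disjoint_paths R' A B P" "finite P" "card P = s" by blast
      then show ?thesis using disjoint_paths_mono[OF _ R'(3)] by blast
    next
      case False
      then obtain Z where Z: "finite Z" "separates R' A B Z" "card Z < s" by force
      \<comment> \<open>A walk that avoids x or y cannot use the arc (x, y), so it survives in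
        \<open>R'\<close> and meets Z.\<close>
      have sep: "separates R A B (insert v Z)" if "v = x \<or> v = y" for v
        unfolding separates_def
      proof (intro allI impI notI)
        fix p assume p: "walk_between R A B p" "set p \<inter> insert v Z = {}"
        then have "x \<notin> set (butlast p) \<or> y \<notin> set (tl p)"
          using that in_set_butlastD[of x p] in_set_tlD[of y p] by auto
        then have "walk_between R' A B p"
          using p(1) successively_Diff_edge[of R p x y] unfolding walk_between_def R'_def by simp
        then show False using separatesD[OF Z(2)] p(2) by blast
      qed
      define X where "X = insert x Z"
      define Y where "Y = insert y Z"
      have fin: "finite X" "finite Y" using Z by (auto simp: X_def Y_def)
      \<comment> \<open>Together with |Z| < s these bounds force |X| = |Y| = s, with x and y outside
        Z.\<close>
      have "s \<le> card X" "s \<le> card Y"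
        using less.prems(3)[OF fin(1)] less.prems(3)[OF fin(2)] sep by (auto simp: X_def Y_def)
      then have card: "card X = s" "card Y = s" "s > 0" and xy: "x \<notin> Z" "y \<notin> Z"
        using Z(1,3) by (auto simp: X_def Y_def card_insert_if split: if_splits)
      have "\<exists>P. disjoint_paths R' A X P \<and> finite P \<and> card P = s"
      proof (rule less.hyps[OF R'(2,1) less.prems(2)])
        fix T assume T: "finite T" "separates R' A X T"
        \<comment> \<open>Every walk from A to B meets X. Up to its first vertex in X it can contain
          x only as its end, so this piece does not use (x, y) and is a walk of \<open>R'\<close>
          from A to X.\<close>
        have "separates R A B T"
          unfolding separates_def
        proof (intro allI impI)
          fix p assume p: "walk_between R A B p"
          then have "\<exists>v\<in>set p. v \<in> X" using separatesD[OF sep[of x]] by (simp add: X_def)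
          then obtain p1 v p2 where p1: "p = p1 @ v # p2" "v \<in> X" "\<forall>u\<in>set p1. u \<notin> X"
            by (rule split_list_first_propE)
          have w: "walk_between R A {v} (p1 @ [v])" using p walk_between_split[of R A B p1 v p2] p1(1) by simp
          have "x \<notin> set (butlast (p1 @ [v]))" using p1 by (auto simp: X_def)
          then have "walk_between R' A X (p1 @ [v])"
            using w p1 successively_Diff_edge[of R "p1 @ [v]" x y]
            unfolding walk_between_def R'_def by auto
          then show "set p \<inter> T \<noteq> {}" using separatesD[OF T(2)] p1(1) by fastforce
        qed
        then show "s \<le> card T" using less.prems(3)[OF T(1)] by simp
      qed
      then obtain P where P: "disjoint_paths R' A X P" "finite P" "card P = s" by blast
      have "\<exists>Q. disjoint_paths R' Y B Q \<and> finite Q \<and> card Q = s"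
      proof (rule less.hyps[OF R'(2,1) fin(2)])
        fix T assume T: "finite T" "separates R' Y B T"
        have "separates R A B T"
          unfolding separates_def
        proof (intro allI impI)
          fix p assume p: "walk_between R A B p"
          then have "\<exists>v\<in>set p. v \<in> Y" using separatesD[OF sep[of y]] by (simp add: Y_def)
          then obtain p1 v p2 where p1: "p = p1 @ v # p2" "v \<in> Y" "\<forall>u\<in>set p2. u \<notin> Y"
            by (rule split_list_last_propE)
          have w: "walk_between R {v} B (v # p2)" using p walk_between_split[of R A B p1 v p2] p1(1) by simp
          have "y \<notin> set (tl (v # p2))" using p1 by (auto simp: Y_def)
          then have "walk_between R' Y B (v # p2)"
            using w p1 successively_Diff_edge[of R "v # p2" x y]
            unfolding walk_between_def R'_def by auto
          then show "set p \<inter> T \<noteq> {}" using separatesD[OF T(2)] p1(1) by fastforce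
        qed
        then show "s \<le> card T" using less.prems(3)[OF T(1)] by simp
      qed
      then obtain Q where Q: "disjoint_paths R' Y B Q" "finite Q" "card Q = s" by blast
      note Pl = disjoint_paths_last[OF P(1) fin(1)] and Qh = disjoint_paths_hd[OF Q(1) fin(2)]
      have bP: "bij_betw last P X" and PX: "\<And>p. p \<in> P \<Longrightarrow> set p \<inter> X = {last p}"
        using Pl P(3) card by simp_all
      have bQ: "bij_betw hd Q Y" and QY: "\<And>p. p \<in> Q \<Longrightarrow> set p \<inter> Y = {hd p}"
        using Qh Q(3) card by simp_all
      have wP: "walk_between R' A X p" "distinct p" "p \<noteq> []" if "p \<in> P" for p
        using P(1) that by (auto simp: disjoint_paths_def walk_between_def)
      have wQ: "walk_between R' Y B p" "distinct p" "p \<noteq> []" if "p \<in> Q" for p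
        using Q(1) that by (auto simp: disjoint_paths_def walk_between_def)
      \<comment> \<open>A common vertex outside Z would join an initial piece of p and a final piece
        of q to a walk of \<open>R'\<close> from A to B. That walk must meet Z, but p meets X only
        in its last vertex and q meets Y only in its first.\<close>
      have meet: "v \<in> Z \<and> v = last p \<and> v = hd q" if pq: "p \<in> P" "q \<in> Q" "v \<in> set p" "v \<in> set q" for p q v
      proof -
        have "v \<in> Z"
        proof (rule ccontr)
          assume v: "v \<notin> Z"
          obtain p1 p2 where p: "p = p1 @ v # p2" using pq(3) by (meson split_list)
          obtain q1 q2 where q: "q = q1 @ v # q2" using pq(4) by (meson split_list)
          have "walk_between R' A {v} (p1 @ [v])"
            using walk_between_split(1)[of R' A X p1 v p2] wP(1)[OF pq(1)] p by simp
          moreover have "walk_between R' {v} B (v # q2)"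
            using walk_between_split(2)[of R' Y B q1 v q2] wQ(1)[OF pq(2)] q by simp
          ultimately have "walk_between R' A B (p1 @ v # q2)" using walk_between_join by metis
          from separatesD[OF Z(2) this] obtain z where z: "z \<in> Z" "z \<in> set (p1 @ v # q2)"
            by auto
          then have "z \<in> set p1 \<or> z \<in> set q2" using v by auto
          then consider "z \<in> set p1" | "z \<in> set q2" by blast
          then show False
          proof cases
            case 1
            then have "z \<in> set p \<inter> X" using z(1) p by (simp add: X_def)
            then have "z = last p" unfolding PX[OF pq(1)] by simp
            moreover have "last p \<in> set (v # p2)" using p by auto
            ultimately have "set p1 \<inter> set (v # p2) \<noteq> {}" using 1 by blast
            then show False using wP(2)[OF pq(1)] unfolding p by simp
          next
            case 2
            then have "z \<in> set q \<inter> Y" using z(1) q by (simp add: Y_def)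
            then have "z = hd q" unfolding QY[OF pq(2)] by simp
            moreover have "hd q \<in> set (q1 @ [v])" using q by (cases q1) auto
            ultimately have "set (q1 @ [v]) \<inter> set q2 \<noteq> {}" using 2 by blast
            then show False using wQ(2)[OF pq(2)] unfolding q by simp
          qed
        qed
        moreover from this have "v \<in> set p \<inter> X" "v \<in> set q \<inter> Y" using pq by (simp_all add: X_def Y_def)
        ultimately show ?thesis unfolding PX[OF pq(1)] QY[OF pq(2)] by simp
      qed
      \<comment> \<open>Each path to X is continued by the path that starts at its end, or at y if
        it ends in x; then the arc (x, y) links the two. Otherwise \<open>butlast\<close> keeps the
        shared vertex from occurring twice.\<close>
      define q where "q p = inv_into Q hd (if last p = x then y else last p)" for p
      define J where "J p = (if last p = x then p @ q p else butlast p @ q p)" for p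
      have qQ: "q p \<in> Q" "hd (q p) = (if last p = x then y else last p)" if "p \<in> P" for p
      proof -
        have "last p \<in> X" using bP that by (auto simp: bij_betw_def)
        then have "(if last p = x then y else last p) \<in> hd ` Q"
          using bQ by (auto simp: bij_betw_def X_def Y_def)
        then show "q p \<in> Q" "hd (q p) = (if last p = x then y else last p)"
          unfolding q_def by (simp_all add: inv_into_into f_inv_into_f)
      qed
      have qinj: "q p \<noteq> q p'" if "p \<in> P" "p' \<in> P" "p \<noteq> p'" for p p'
      proof
        assume "q p = q p'"
        then have eq: "(if last p = x then y else last p) = (if last p' = x then y else last p')"
          using qQ(2)[OF that(1)] qQ(2)[OF that(2)] by argo
        have "last p \<in> X" "last p' \<in> X" using bP that by (auto simp: bij_betw_def)
        moreover have "last p \<noteq> last p'" using bP that unfolding bij_betw_def inj_on_def by blast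
        ultimately show False using eq xy unfolding X_def by (metis insertE)
      qed
      have setJ: "set (J p) = set p \<union> set (q p)" if "p \<in> P" for p
      proof (cases "last p = x")
        case False
        have "last p \<in> set (q p)" using qQ[OF that] wQ(3) False by (metis hd_in_set)
        moreover have "set p = insert (last p) (set (butlast p))"
          using arg_cong[OF append_butlast_last_id[OF wP(3)[OF that]], of set] by simp
        ultimately have "set p \<union> set (q p) = set (butlast p) \<union> set (q p)"
          by (simp add: insert_absorb)
        then show ?thesis using False by (simp add: J_def)
      next
        case True
        then show ?thesis by (simp add: J_def)
      qed
      have walkJ: "walk_between R A B (J p) \<and> distinct (J p)" if p: "p \<in> P" for p
      proof (cases "last p = x")
        case True
        have "walk_between R A X p" "walk_between R Y B (q p)"
          using walk_between_mono[OF wP(1)[OF p] R'(3)] walk_between_mono[OF wQ(1)[OF qQ(1)[OF p]] R'(3)]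
          by simp_all
        then have "walk_between R A B (J p)"
          using True e qQ(2)[OF p]
          by (auto simp: J_def walk_between_def successively_append_iff)
        moreover have "set p \<inter> set (q p) = {}"
          using meet[OF p qQ(1)[OF p]] True xy by (metis disjoint_iff)
        ultimately show ?thesis
          using True wP(2)[OF p] wQ(2)[OF qQ(1)[OF p]] by (simp add: J_def)
      next
        case False
        define v where "v = last p"
        obtain r where r: "q p = v # r"
          using wQ(3)[OF qQ(1)[OF p]] qQ(2)[OF p] False by (cases "q p") (auto simp: v_def)
        have pv: "p = butlast p @ [v]" using wP(3)[OF p] by (simp add: v_def)
        have "walk_between R' A {v} (butlast p @ [v])"
          using wP(1)[OF p] pv unfolding walk_between_def by (simp add: v_def)
        moreover have "walk_between R' {v} B (v # r)"
          using wQ(1)[OF qQ(1)[OF p]] unfolding r walk_between_def by simp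
        ultimately have "walk_between R' A B (J p)"
          using walk_between_join False r by (simp add: J_def)
        moreover have "set (butlast p) \<inter> set (q p) = {}"
        proof -
          have "distinct (butlast p @ [v])" using wP(2)[OF p] pv by simp
          then have "v \<notin> set (butlast p)" by simp
          then show ?thesis using meet[OF p qQ(1)[OF p]] in_set_butlastD[of _ p]
            unfolding v_def by (metis disjoint_iff)
        qed
        ultimately show ?thesis
          using False wP(2)[OF p] wQ(2)[OF qQ(1)[OF p]] walk_between_mono[of R' A B "J p", OF _ R'(3)]
          by (simp add: J_def distinct_butlast)
      qed
      have disj: "set (J p) \<inter> set (J p') = {}" if p: "p \<in> P" "p' \<in> P" "p \<noteq> p'" for p p'
      proof -
        have PQ: "set p \<inter> set p' = {}" "set (q p) \<inter> set (q p') = {}"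
          using P(1) Q(1) p qQ(1)[OF p(1)] qQ(1)[OF p(2)] qinj[OF p]
          unfolding disjoint_paths_def pairwise_def by simp_all
        have cross: "set r \<inter> set (q r') = {}" if r: "r \<in> P" "r' \<in> P" "r \<noteq> r'" for r r'
        proof (rule ccontr)
          assume "set r \<inter> set (q r') \<noteq> {}"
          then obtain v where v: "v \<in> set r" "v \<in> set (q r')" by blast
          have *: "v \<in> Z" "v = last r" "v = hd (q r')"
            using meet[OF r(1) qQ(1)[OF r(2)] v] by blast+
          then have "last r = last r'" using qQ(2)[OF r(2)] xy by (metis (full_types))
          then show False using bP r unfolding bij_betw_def inj_on_def by metis
        qed
        show ?thesis
          using PQ cross[OF p] cross[OF p(2,1)] p(3) unfolding setJ[OF p(1)] setJ[OF p(2)] by blast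
      qed
      have "inj_on J P"
      proof (rule inj_onI, rule ccontr)
        fix p p' assume p: "p \<in> P" "p' \<in> P" "J p = J p'" "p \<noteq> p'"
        then have "set (J p) = {}" using disj[of p p'] by simp
        then show False using setJ[OF p(1)] wP(3)[OF p(1)] by simp
      qed
      then have "card (J ` P) = s" using P(3) by (simp add: card_image)
      moreover have "disjoint_paths R A B (J ` P)"
        unfolding disjoint_paths_def
      proof (intro conjI ballI pairwiseI)
        fix w assume "w \<in> J ` P"
        then show "walk_between R A B w" "distinct w" using walkJ by blast+
      next
        fix w w' assume "w \<in> J ` P" "w' \<in> J ` P" "w \<noteq> w'"
        then obtain p p' where "p \<in> P" "p' \<in> P" "p \<noteq> p'" "w = J p" "w' = J p'" by blast
        then show "set w \<inter> set w' = {}" using disj by simp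
      qed
      ultimately show ?thesis using P(2) by (intro exI[of _ "J ` P"]) simp
    qed
  qed
qed

section \<open>Inequalities for the cut parameters\<close>

text \<open>In this section D stands for d, e for the slack s, t for d - |S| and a for |A|; F and G
  are the numbers of out-neighbours in A and of in-neighbours in B of cut vertices. The upper bound
  on 2 (c D + 1 - e) is the negation of the estimate wanted for |S|. Here e < c^2 D makes its left
  side exceed 2 (1 - c) c D, and 1 - c cancels.\<close>

lemma slack_weighted:
  fixes c D e t :: real
  assumes "0 < c" "c < 1" "2 * (c * D + 1 - e) \<le> (1 - c) * (2 - c) * (t + e)" "e < c\<^sup>2 * D"
  shows "2 * c * D < (2 - c) * (t + e)"
proof -
  have "(1 - c) * (2 * c * D) < 2 * (c * D + 1 - e)"
    using assms(4) by (simp add: algebra_simps power2_eq_square)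
  also have "\<dots> \<le> (1 - c) * ((2 - c) * (t + e))" using assms(3) by (simp add: mult.assoc)
  finally show ?thesis using assms(2) by simp
qed

lemma slack_weighted_consequences:
  fixes c D e t :: real
  assumes c: "0 < c" "c < 1" and D: "0 \<le> D"
    and neg: "2 * (c * D + 1 - e) \<le> (1 - c) * (2 - c) * (t + e)" and e: "e < c\<^sup>2 * D"
  shows "c * D < t + e" and "0 < t"
proof -
  have "(2 - c) * (c * D) \<le> 2 * c * D" using D c by (simp add: algebra_simps)
  also have "\<dots> < (2 - c) * (t + e)" using slack_weighted[OF c neg e] .
  finally show te: "c * D < t + e" using c by simp
  have "c\<^sup>2 * D \<le> c * D"
    using D c by (intro mult_right_mono) (auto simp: power2_eq_square mult_left_le)
  then show "0 < t" using te e by simp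
qed

text \<open>This shows that a cut vertex with arcs back to A has too many out-neighbours in A to be
  the vertex of small out-degree in A enlarged by part of the cut. The summand c (1 - c) absorbs the
  rounding of the size of that part. The bound c (3 - c) \<le> 1 enters as 1 - 3 c + c^2 \<ge> 0,
  the coefficient with which t is replaced by c a.\<close>

lemma small_degree_bound:
  fixes c D e t a F :: real
  assumes c: "0 < c" "c < 1" "c * (3 - c) \<le> 1" and D: "0 \<le> D"
    and neg: "2 * (c * D + 1 - e) \<le> (1 - c) * (2 - c) * (t + e)" and e: "e < c\<^sup>2 * D"
    and a: "t < c * a" and F: "e + (1 - c) * t - c * D + c * a < c * (2 - c) * F"
  shows "c * (a - t) + c * (1 - c) \<le> (1 - c) * F"
proof -
  \<comment> \<open>The factor is 3 - 3 c + c^2, and c times it is 1 - (1 - c)^3.\<close>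
  have "e * (1 + (1 - c) * (2 - c)) \<le> c\<^sup>2 * D * (1 + (1 - c) * (2 - c))"
    using e c by (intro mult_right_mono add_nonneg_nonneg mult_nonneg_nonneg) auto
  also have "\<dots> = c * D * (1 - (1 - c) ^ 3)"
    by (simp add: algebra_simps power2_eq_square power3_eq_cube)
  also have "\<dots> \<le> c * D" using c D by (intro mult_left_le mult_nonneg_nonneg) auto
  finally have eD: "e * (1 + (1 - c) * (2 - c)) \<le> c * D" .
  have "c\<^sup>2 * (2 - c) \<le> 1 * 2" using c by (intro mult_mono power_le_one) auto
  then have small: "c\<^sup>2 * (2 - c) \<le> 2" by simp
  have key: "c * D + c\<^sup>2 * (2 - c) \<le> e + (1 - c) * (2 - c) * t"
    using neg eD small by (simp add: algebra_simps)
  have "(1 - 3 * c + c\<^sup>2) * t \<le> (1 - 3 * c + c\<^sup>2) * (c * a)"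
    using a c by (intro mult_left_mono) (auto simp: algebra_simps power2_eq_square)
  moreover have "(1 - c) * (c * D + c\<^sup>2 * (2 - c)) \<le> (1 - c) * (e + (1 - c) * (2 - c) * t)"
    using key c by (intro mult_left_mono) auto
  moreover have "(1 - c) * (e + (1 - c) * t - c * D + c * a) \<le> (1 - c) * (c * (2 - c) * F)"
    using F c by (intro mult_left_mono) auto
  ultimately have "c * (2 - c) * (c * (a - t) + c * (1 - c)) \<le> c * (2 - c) * ((1 - c) * F)"
    by (simp add: algebra_simps power2_eq_square power3_eq_cube)
  then show ?thesis using c by simp
qed

text \<open>This will exclude an arc from the chosen z to a cut vertex with F out-neighbours in A
  when z has no in-neighbour in B. Eliminating F, a, t + e and e in turn leaves a multiple of D; the
  bounds 1/3 < c < 2/5 give the signs of the coefficients.\<close>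

lemma neighbourhood_overflow:
  fixes c D e t a F :: real
  assumes c: "1 / 3 < c" "c < 2 / 5" and D: "0 \<le> D"
    and neg: "2 * (c * D + 1 - e) \<le> (1 - c) * (2 - c) * (t + e)" and e: "e < c\<^sup>2 * D"
    and a: "2 * a \<le> 2 * D + t - e" and F: "e + (1 - c) * t - c * D + c * a < c * (2 - c) * F"
  shows "c * a < c * (F + t) + e"
proof (rule ccontr)
  assume "\<not> ?thesis"
  then have "(2 - c) * (c * F) \<le> (2 - c) * (c * a - c * t - e)"
    using c by (intro mult_left_mono) (auto simp: algebra_simps)
  moreover have "c * (1 - c) * (2 * a) \<le> c * (1 - c) * (2 * D + t - e)"
    using a c by (intro mult_left_mono) auto
  ultimately have "(2 + c * (1 - c)) * (t + e) + 2 * (2 - c) * e < 2 * c * (2 - c) * D"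
    using F by (simp add: algebra_simps)
  then have "(1 - c) * (2 - c) * ((2 + c * (1 - c)) * (t + e) + 2 * (2 - c) * e)
      < (1 - c) * (2 - c) * (2 * c * (2 - c) * D)"
    using c by (intro mult_strict_left_mono) auto
  moreover have "(2 + c * (1 - c)) * (2 * (c * D + 1 - e))
      \<le> (2 + c * (1 - c)) * ((1 - c) * (2 - c) * (t + e))"
    using neg c by (intro mult_left_mono) (auto intro!: add_nonneg_nonneg mult_nonneg_nonneg)
  moreover have "(-2 + 9 * c - 6 * c\<^sup>2 + c ^ 3) * e \<le> (-2 + 9 * c - 6 * c\<^sup>2 + c ^ 3) * (c\<^sup>2 * D)"
  proof (intro mult_left_mono)
    have "0 \<le> (3 * c - 1) * (2 - 2 * c) + c ^ 3 + c" using c by simp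
    then show "0 \<le> -2 + 9 * c - 6 * c\<^sup>2 + c ^ 3" by (simp add: algebra_simps power2_eq_square)
  qed (use e in simp)
  moreover have "0 \<le> c * ((3 * c - 1) * (2 - 5 * c) + c ^ 3 * (7 - c)) * D"
    using c D by (intro mult_nonneg_nonneg add_nonneg_nonneg) auto
  moreover have "0 < 2 * (2 + c * (1 - c))"
    using c by (intro mult_pos_pos add_pos_nonneg mult_nonneg_nonneg) auto
  ultimately show False
    by (simp add: algebra_simps power2_eq_square power3_eq_cube power4_eq_xxxx)
qed

text \<open>The companion for a vertex z with G in-neighbours in B. The bound on G will come from
  \<open>return_arcs\<close> in the reversed digraph.\<close>

lemma neighbourhood_overflow_backward:
  fixes c D e t a F G :: real
  assumes c: "1 / 3 < c" "c < 2 / 5" and D: "0 \<le> D"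
    and neg: "2 * c * D < (2 - c) * (t + e)" and e: "0 \<le> e"
    and a: "t < c * a" and F: "e + (1 - c) * t - c * D + c * a < c * (2 - c) * F"
    and G: "(1 - c) * G < D - a - e"
  shows "c * a < c * (F + t - G) + e"
proof (rule ccontr)
  assume "\<not> ?thesis"
  then have "(1 - c) * (2 - c) * (c * F) \<le> (1 - c) * (2 - c) * (c * a - c * t + c * G - e)"
    using c by (intro mult_left_mono mult_nonneg_nonneg) (auto simp: algebra_simps)
  moreover have "c * (2 - c) * ((1 - c) * G) \<le> c * (2 - c) * (D - a - e)"
    using G c by (intro mult_left_mono) auto
  moreover have "(1 - c) * (e + (1 - c) * t - c * D + c * a) < (1 - c) * (c * (2 - c) * F)"
    using F c by (intro mult_strict_left_mono) auto
  moreover have "(1 + c * (1 - c)) * t \<le> (1 + c * (1 - c)) * (c * a)"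
    using a c by (intro mult_left_mono add_nonneg_nonneg mult_nonneg_nonneg) auto
  ultimately have "(3 - 2 * c) * e + (2 + c - 3 * c\<^sup>2 + c ^ 3) * t < (3 - 2 * c) * (c * D)"
    by (simp add: algebra_simps power2_eq_square power3_eq_cube)
  moreover have "(2 + c - 3 * c\<^sup>2 + c ^ 3) * e \<le> (3 - 2 * c) * e"
  proof (intro mult_right_mono)
    have "0 \<le> (1 - c) ^ 3" using c by simp
    then show "2 + c - 3 * c\<^sup>2 + c ^ 3 \<le> 3 - 2 * c"
      by (simp add: algebra_simps power2_eq_square power3_eq_cube)
  qed (use e in simp)
  ultimately have "(2 + c - 3 * c\<^sup>2 + c ^ 3) * (t + e) < (3 - 2 * c) * (c * D)"
    by (simp add: algebra_simps)
  then have "(2 - c) * ((2 + c - 3 * c\<^sup>2 + c ^ 3) * (t + e)) < (2 - c) * ((3 - 2 * c) * (c * D))"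
    using c by (intro mult_strict_left_mono) auto
  moreover have "(2 + c - 3 * c\<^sup>2 + c ^ 3) * (2 * c * D) \<le> (2 + c - 3 * c\<^sup>2 + c ^ 3) * ((2 - c) * (t + e))"
  proof (intro mult_left_mono)
    have "0 \<le> 2 * (1 - c) + 3 * c * (1 - c) + c ^ 3" using c by (intro add_nonneg_nonneg mult_nonneg_nonneg) auto
    then show "0 \<le> 2 + c - 3 * c\<^sup>2 + c ^ 3" by (simp add: algebra_simps power2_eq_square)
  qed (use neg in simp)
  moreover have "0 \<le> (c * D) * ((3 * c - 1) * (2 - 2 * c) + c * (1 - 2 * c) + 2 * c ^ 3)"
    using c D by (intro mult_nonneg_nonneg add_nonneg_nonneg) auto
  ultimately show False
    by (simp add: algebra_simps power2_eq_square power3_eq_cube)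
qed

section \<open>Digraphs without short cycles\<close>

lemma card_disjoint4_le:
  assumes "finite X" "P1 \<union> P2 \<union> P3 \<union> P4 \<subseteq> X"
    and "P1 \<inter> P2 = {}" "P1 \<inter> P3 = {}" "P1 \<inter> P4 = {}" "P2 \<inter> P3 = {}" "P2 \<inter> P4 = {}" "P3 \<inter> P4 = {}"
  shows "card P1 + card P2 + card P3 + card P4 \<le> card X"
proof -
  have fin: "finite P1" "finite P2" "finite P3" "finite P4" using assms(1,2) by (auto intro: finite_subset)
  have "card P1 + card P2 + card P3 + card P4 = card (P1 \<union> P2 \<union> P3 \<union> P4)"
    using fin assms(3-) by (subst card_Un_disjoint; auto)+
  also have "\<dots> \<le> card X" using assms by (intro card_mono) auto
  finally show ?thesis .
qed

lemma card_disjoint3_le: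
  assumes "finite X" "P1 \<union> P2 \<union> P3 \<subseteq> X" "P1 \<inter> P2 = {}" "P1 \<inter> P3 = {}" "P2 \<inter> P3 = {}"
  shows "card P1 + card P2 + card P3 \<le> card X"
  using card_disjoint4_le[of X P1 P2 P3 "{}"] assms by simp

lemma card_disjoint2_le:
  assumes "finite X" "P1 \<union> P2 \<subseteq> X" "P1 \<inter> P2 = {}"
  shows "card P1 + card P2 \<le> card X"
  using card_disjoint3_le[of X P1 P2 "{}"] assms by simp

lemma rel_short_cycle_mono: "rel_short_cycle R \<Longrightarrow> R \<subseteq> R' \<Longrightarrow> rel_short_cycle R'"
  unfolding rel_short_cycle_def by blast

lemma rel_short_cycle_converse [simp]: "rel_short_cycle (R\<inverse>) = rel_short_cycle R"
  unfolding rel_short_cycle_def by blast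

lemma exists_small_out_degree:
  assumes "forces_short_cycle c" "finite U" "\<not> rel_short_cycle R" "U \<noteq> {}"
  shows "\<exists>v\<in>U. real (card (R `` {v} \<inter> U)) < c * real (card U)"
proof (rule ccontr)
  assume *: "\<not> ?thesis"
  have "rel_short_cycle (R \<inter> U \<times> U)"
  proof (rule forces_short_cycle_rel[OF assms(1,2,4)])
    fix v assume "v \<in> U"
    then have "(R \<inter> U \<times> U) `` {v} = R `` {v} \<inter> U" by auto
    then show "c * real (card U) \<le> real (card ((R \<inter> U \<times> U) `` {v}))"
      using * \<open>v \<in> U\<close> by (simp add: not_less)
  qed auto
  then show False using assms(3) rel_short_cycle_mono by blast
qed

text \<open>A plain relation with lower bounds on both degrees gives a class closed under reversal,
  so every lemma has a mirror image. Given c \<le> 1, the last assumption says c \<le> (3 - sqrt 5)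
  / 2.\<close>

locale short_cycle_free =
  fixes V :: "'v set" and R :: "'v rel" and d :: nat and c :: real
  assumes finite_V: "finite V" and R_subset: "R \<subseteq> V \<times> V" and no_short_cycle: "\<not> rel_short_cycle R"
    and out_degree: "v \<in> V \<Longrightarrow> d \<le> card (R `` {v})"
    and in_degree: "v \<in> V \<Longrightarrow> d \<le> card (R\<inverse> `` {v})"
    and forces: "forces_short_cycle c" and c_le_1: "c \<le> 1" and c_bound: "c * (3 - c) \<le> 1"
begin

lemma converse: "short_cycle_free V (R\<inverse>) d c"
  using finite_V R_subset no_short_cycle out_degree in_degree forces c_le_1 c_bound
  by unfold_locales auto

lemma irrefl: "(u, u) \<notin> R"
  and asym: "(u, v) \<in> R \<Longrightarrow> (v, u) \<notin> R"
  and no_triangle: "(u, v) \<in> R \<Longrightarrow> (v, w) \<in> R \<Longrightarrow> (w, u) \<notin> R"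
  using no_short_cycle unfolding rel_short_cycle_def by blast+

lemma c_pos: "0 < c"
  using forces_short_cycle_ge[OF forces] by simp

lemma c_less: "c < 2 / 5"
proof (rule ccontr)
  assume "\<not> c < 2 / 5"
  \<comment> \<open>The product equals c (3 - c) - 26/25, which \<open>c_bound\<close> makes
    negative.\<close>
  then have "0 \<le> (c - 2 / 5) * (13 / 5 - c)" using c_le_1 by simp
  then show False using c_bound by (simp add: field_simps)
qed

lemma finite_subset_V: "U \<subseteq> V \<Longrightarrow> finite U"
  using finite_V finite_subset by blast

lemma out_subset: "R `` U \<subseteq> V" and in_subset: "R\<inverse> `` U \<subseteq> V"
  using R_subset by auto

lemma finite_out [simp]: "finite (R `` U)" and finite_in [simp]: "finite (R\<inverse> `` U)"
  by (rule finite_subset_V[OF out_subset], rule finite_subset_V[OF in_subset])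

lemma obtain_small_out_degree:
  assumes "U \<subseteq> V" "U \<noteq> {}"
  obtains v where "v \<in> U" "real (card (R `` {v} \<inter> U)) < c * real (card U)"
  using exists_small_out_degree[OF forces finite_subset_V no_short_cycle] assms by metis

abbreviation slack :: real where "slack \<equiv> 3 * real d + 1 - real (card V)"

text \<open>Let U be the set of common out-neighbours and choose w in U with few out-neighbours in
  U. As (u, v), (u, w) and (v, w) are arcs, N+(v) and N+(w) avoid N-(u) and N-(v). Since U lies in
  N+(v), their union has at least d + (1 - c) |U| elements. Inclusion-exclusion for N-(u) and N-(v)
  finishes; the vertex v, outside all these sets, supplies the 1 in \<open>slack\<close>.\<close>

lemma common_in_neighbours:
  assumes uv: "(u, v) \<in> R"
  shows "slack + (1 - c) * real (card (R `` {u} \<inter> R `` {v})) \<le> real (card (R\<inverse> `` {u} \<inter> R\<inverse> `` {v}))"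
proof -
  define U where "U = R `` {u} \<inter> R `` {v}"
  have V: "u \<in> V" "v \<in> V" using uv R_subset by auto
  have UV: "U \<subseteq> V" using out_subset by (auto simp: U_def)
  obtain W where W: "W \<subseteq> V" "W \<inter> (R\<inverse> `` {u} \<union> R\<inverse> `` {v}) = {}" "v \<notin> W"
    "real d + (1 - c) * real (card U) \<le> real (card W)"
  proof (cases "U = {}")
    case True
    show thesis
    proof
      show "R `` {v} \<inter> (R\<inverse> `` {u} \<union> R\<inverse> `` {v}) = {}" using no_triangle[OF uv] by (auto dest: asym)
      show "v \<notin> R `` {v}" using irrefl by auto
    qed (use True out_degree[OF V(2)] out_subset in auto)
  next
    case False
    then obtain w where w: "w \<in> U" "real (card (R `` {w} \<inter> U)) < c * real (card U)"
      using obtain_small_out_degree UV by metis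
    show thesis
    proof
      have uw: "(u, w) \<in> R" "(v, w) \<in> R" using w(1) by (auto simp: U_def)
      show "(R `` {v} \<union> R `` {w}) \<inter> (R\<inverse> `` {u} \<union> R\<inverse> `` {v}) = {}"
        using no_triangle[OF uv] no_triangle[OF uw(1)] no_triangle[OF uw(2)] by (auto dest: asym)
      show "v \<notin> R `` {v} \<union> R `` {w}" using irrefl asym[OF uw(2)] by auto
      have "card (R `` {w}) + card (U - R `` {w}) \<le> card (R `` {v} \<union> R `` {w})"
        by (intro card_disjoint2_le) (auto simp: U_def)
      moreover have "card U = card (U \<inter> R `` {w}) + card (U - R `` {w})"
        using UV finite_subset_V card_Int_Diff by metis
      moreover have "d \<le> card (R `` {w})" using w(1) UV out_degree by blast
      ultimately show "real d + (1 - c) * real (card U) \<le> real (card (R `` {v} \<union> R `` {w}))"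
        using w(2) by (simp add: algebra_simps Int_commute)
    qed (use out_subset in auto)
  qed
  have "card W + card (R\<inverse> `` {u} \<union> R\<inverse> `` {v}) + card {v} \<le> card V"
    using W(1-3) V(2) irrefl[of v] asym[OF uv] in_subset[of "{u}"] in_subset[of "{v}"] finite_V
    by (intro card_disjoint3_le) auto
  moreover have "card (R\<inverse> `` {u}) + card (R\<inverse> `` {v})
      = card (R\<inverse> `` {u} \<union> R\<inverse> `` {v}) + card (R\<inverse> `` {u} \<inter> R\<inverse> `` {v})"
    by (rule card_Un_Int) auto
  ultimately show ?thesis
    using W(4) in_degree[OF V(1)] in_degree[OF V(2)] by (simp add: U_def)
qed

text \<open>Inserting \<open>common_in_neighbours\<close> into its mirror image leaves the factor 1
  - (1 - c)^2 = c (2 - c) on one side and 2 - c on the other.\<close>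

lemma common_out_neighbours:
  assumes "(u, v) \<in> R"
  shows "slack \<le> c * real (card (R `` {u} \<inter> R `` {v}))"
proof -
  interpret conv: short_cycle_free V "R\<inverse>" d c by (rule converse)
  define p where "p = real (card (R `` {u} \<inter> R `` {v}))"
  define q where "q = real (card (R\<inverse> `` {u} \<inter> R\<inverse> `` {v}))"
  have "slack + (1 - c) * p \<le> q" using common_in_neighbours[OF assms] by (simp add: p_def q_def)
  then have "(1 - c) * (slack + (1 - c) * p) \<le> (1 - c) * q"
    using c_le_1 by (intro mult_left_mono) auto
  moreover have "slack + (1 - c) * q \<le> p"
    using conv.common_in_neighbours[of v u] assms by (simp add: p_def q_def Int_commute)
  ultimately have "(2 - c) * slack \<le> (2 - c) * (c * p)" by (simp add: algebra_simps)
  then show ?thesis using c_le_1 by (simp add: p_def)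
qed

text \<open>Some w in N+(v) has fewer than c d out-neighbours in N+(v);
  \<open>common_out_neighbours\<close> is applied to the arc (v, w).\<close>

lemma slack_less:
  assumes "v \<in> V" "card (R `` {v}) = d" "d \<ge> 1"
  shows "slack < c\<^sup>2 * real d"
proof -
  have "R `` {v} \<noteq> {}" using assms by auto
  then obtain w where w: "w \<in> R `` {v}" "real (card (R `` {w} \<inter> R `` {v})) < c * real d"
    using obtain_small_out_degree out_subset assms(2) by metis
  have "slack \<le> c * real (card (R `` {v} \<inter> R `` {w}))"
    using common_out_neighbours w(1) by auto
  also have "\<dots> < c * (c * real d)" using w(2) c_pos by (simp add: Int_commute)
  finally show ?thesis by (simp add: power2_eq_square)
qed

lemma slack_less_semi:
  assumes "v \<in> V" "card (R `` {v}) = d \<or> card (R\<inverse> `` {v}) = d" "d \<ge> 1"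
  shows "slack < c\<^sup>2 * real d"
  using assms slack_less short_cycle_free.slack_less[OF converse] by blast

end

text \<open>\<open>out_closed\<close> also forbids arcs from A to x, and \<open>in_closed\<close>
  arcs from x to B, so that reversal exchanges A and B.\<close>

locale separation = short_cycle_free V R d c for V :: "'v set" and R d c +
  fixes x :: 'v and A S B :: "'v set"
  assumes V_eq: "V = insert x (A \<union> S \<union> B)"
    and disjoint: "x \<notin> A" "x \<notin> S" "x \<notin> B" "A \<inter> S = {}" "A \<inter> B = {}" "S \<inter> B = {}"
    and out_closed: "y \<in> A \<Longrightarrow> R `` {y} \<subseteq> A \<union> S"
    and in_closed: "y \<in> B \<Longrightarrow> R\<inverse> `` {y} \<subseteq> B \<union> S"
begin

lemma converse_separation: "separation V (R\<inverse>) d c x B S A"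
proof -
  interpret conv: short_cycle_free V "R\<inverse>" d c by (rule converse)
  show ?thesis
    using V_eq disjoint out_closed in_closed by unfold_locales auto
qed

lemma subsets: "A \<subseteq> V" "S \<subseteq> V" "B \<subseteq> V"
  and finites [simp]: "finite A" "finite S" "finite B"
  using V_eq finite_V by auto

lemma card_V: "card V = 1 + card A + card S + card B"
  unfolding V_eq using disjoint by (simp add: card_Un_disjoint Int_Un_distrib2)

lemma degree_bound_A:
  assumes "A \<noteq> {}"
  shows "real d - real (card S) < c * real (card A)"
proof -
  obtain y where y: "y \<in> A" "real (card (R `` {y} \<inter> A)) < c * real (card A)"
    using obtain_small_out_degree subsets assms by metis
  have "R `` {y} \<subseteq> (R `` {y} \<inter> A) \<union> S" using out_closed y(1) by blast
  then have "card (R `` {y}) \<le> card ((R `` {y} \<inter> A) \<union> S)" by (intro card_mono) auto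
  also have "\<dots> \<le> card (R `` {y} \<inter> A) + card S" by (rule card_Un_le)
  finally show ?thesis using out_degree[of y] y subsets by auto
qed

text \<open>Choose v in F = N+(z) \<inter> A with few out-neighbours in F. Inside A \<union> S the
  sets N+(v), N-(z), F - N+(v) and {z} are disjoint, because the arc (z, v) lies on no short cycle.
  So N-(z) is small there and its other elements lie in B, except possibly x, for which {z}
  compensates.\<close>

lemma return_arcs:
  assumes z: "z \<in> S" and F: "R `` {z} \<inter> A \<noteq> {}"
  shows "2 * real d - real (card S) - real (card A) + (1 - c) * real (card (R `` {z} \<inter> A))
    < real (card (R\<inverse> `` {z} \<inter> B))"
proof -
  define F where "F = R `` {z} \<inter> A"
  obtain v where v: "v \<in> F" "real (card (R `` {v} \<inter> F)) < c * real (card F)"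
    using obtain_small_out_degree[of F] F subsets by (auto simp: F_def)
  have vA: "v \<in> A" "(z, v) \<in> R" using v by (auto simp: F_def)
  have "card (R `` {v}) + card (R\<inverse> `` {z} \<inter> (A \<union> S)) + card (F - R `` {v}) + card {z} \<le> card (A \<union> S)"
    using vA out_closed[OF vA(1)] irrefl[of z] no_triangle[OF vA(2)] z disjoint
    by (intro card_disjoint4_le) (auto simp: F_def dest: asym)
  moreover have "card (A \<union> S) = card A + card S" using disjoint by (simp add: card_Un_disjoint)
  moreover have "card F = card (R `` {v} \<inter> F) + card (F - R `` {v})"
    using card_Int_Diff[of F "R `` {v}"] by (simp add: F_def Int_commute)
  moreover have "card (R\<inverse> `` {z}) \<le> card ((R\<inverse> `` {z} \<inter> (A \<union> S)) \<union> ((R\<inverse> `` {z} \<inter> B) \<union> {x}))"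
    using in_subset[of "{z}"] V_eq by (intro card_mono) auto
  moreover have "\<dots> \<le> card (R\<inverse> `` {z} \<inter> (A \<union> S)) + (card (R\<inverse> `` {z} \<inter> B) + card {x})"
    by (intro card_Un_le[THEN order_trans] add_left_mono card_Un_le)
  moreover have "d \<le> card (R\<inverse> `` {z})" "d \<le> card (R `` {v})"
    using in_degree out_degree z vA subsets by auto
  ultimately show ?thesis using v(2) by (simp add: F_def[symmetric] algebra_simps)
qed

lemma cut_contradiction:
  assumes ne: "A \<noteq> {}" "B \<noteq> {}" and le: "card A \<le> card B"
    and c3: "1 / 3 < c" and slack0: "0 \<le> slack" and slack: "slack < c\<^sup>2 * real d"
    and neg: "2 * (c * real d + 1 - slack) \<le> (1 - c) * (2 - c) * (real d - real (card S) + slack)"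
  shows False
proof -
  interpret conv: separation V "R\<inverse>" d c x B S A by (rule converse_separation)
  define D where "D = real d"
  define e where "e = slack"
  define k where "k = real (card S)"
  define t where "t = D - k"
  define a where "a = real (card A)"
  define b where "b = real (card B)"
  have D0: "0 \<le> D" by (simp add: D_def)
  have ab: "a + b = 2 * D + t - e" using card_V by (simp add: a_def b_def D_def e_def t_def k_def)
  have a2: "2 * a \<le> 2 * D + t - e" using ab le by (simp add: a_def b_def)
  have N: "2 * (c * D + 1 - e) \<le> (1 - c) * (2 - c) * (t + e)"
    using neg by (simp add: D_def e_def t_def k_def)
  have M: "e < c\<^sup>2 * D" "0 \<le> e" using slack slack0 by (simp_all add: D_def e_def)
  have W: "2 * c * D < (2 - c) * (t + e)" using slack_weighted[OF c_pos _ N M(1)] c_less by simp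
  have te: "c * D < t + e" and t0: "0 < t"
    using slack_weighted_consequences[OF c_pos _ D0 N M(1)] c_less by simp_all
  have ta: "t < c * a" using degree_bound_A[OF ne(1)] by (simp add: t_def a_def D_def k_def)
  \<comment> \<open>The vertices of the cut with an arc back to A. Each of them has many arcs to A, so after
    adding some of them to A a vertex of small out-degree still lies in A itself.\<close>
  define S1 where "S1 = {z \<in> S. R `` {z} \<inter> A \<noteq> {}}"
  have S1: "S1 \<subseteq> S" "finite S1" by (auto simp: S1_def)
  \<comment> \<open>\<open>return_arcs\<close> gives z many in-neighbours in B, and its mirror image
    turns these into many out-neighbours in A. The two passes leave F with the factor 1 - (1 - c)^2
    = c (2 - c).\<close>
  have bigF: "e + (1 - c) * t - c * D + c * a < c * (2 - c) * real (card (R `` {z} \<inter> A))"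
    if "z \<in> S1" for z
  proof -
    define F where "F = real (card (R `` {z} \<inter> A))"
    define G where "G = real (card (R\<inverse> `` {z} \<inter> B))"
    have z: "z \<in> S" "R `` {z} \<inter> A \<noteq> {}" using that by (auto simp: S1_def)
    have G: "D + t - a + (1 - c) * F < G"
      using return_arcs[OF z] by (simp add: F_def G_def t_def D_def k_def a_def)
    have "0 \<le> (1 - c) * F" using c_le_1 by (simp add: F_def)
    then have "0 < G" using G a2 t0 M by linarith
    then have "R\<inverse> `` {z} \<inter> B \<noteq> {}" by (auto simp: G_def)
    then have "D + t - b + (1 - c) * G < F"
      using conv.return_arcs[OF z(1)] by (simp add: F_def G_def t_def D_def k_def b_def)
    moreover have "(1 - c) * (D + t - a + (1 - c) * F) \<le> (1 - c) * G"
      using G c_le_1 by (intro mult_left_mono) auto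
    ultimately show ?thesis using ab by (simp add: F_def[symmetric] algebra_simps)
  qed
  have S1_small: "(1 - c) * real (card S1) < c * a - t"
  proof (rule ccontr)
    assume "\<not> ?thesis"
    then have big: "(c * a - t) / (1 - c) \<le> real (card S1)" using c_less by (simp add: field_simps)
    \<comment> \<open>J is the least number of vertices of S1 whose addition to A rules out a vertex
      y of A as the one of small out-degree: y has at least d - (|S| - J) out-neighbours in the
      enlarged set, and this is at least c (a + J).\<close>
    define J where "J = nat \<lceil>(c * a - t) / (1 - c)\<rceil>"
    have pos: "0 < (c * a - t) / (1 - c)" using ta c_less by simp
    have J: "(c * a - t) / (1 - c) \<le> real J" "real J < (c * a - t) / (1 - c) + 1" "J \<le> card S1"
      using pos big unfolding J_def by (linarith, linarith, simp add: nat_le_iff ceiling_le_iff)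
    obtain T where T: "T \<subseteq> S1" "card T = J" "finite T"
      using J(3) obtain_subset_with_card_n by metis
    have "A \<union> T \<subseteq> V" using T S1 subsets by auto
    then obtain y where y: "y \<in> A \<union> T" "real (card (R `` {y} \<inter> (A \<union> T))) < c * real (card (A \<union> T))"
      using obtain_small_out_degree ne(1) by (metis Un_empty)
    have cardAT: "real (card (A \<union> T)) = a + J"
      using T S1 disjoint by (subst card_Un_disjoint) (auto simp: a_def)
    have J': "(1 - c) * real J \<ge> c * a - t" "(1 - c) * real J < c * a - t + (1 - c)"
      using J c_less by (simp_all add: field_simps)
    have "y \<notin> T"
    proof
      assume yT: "y \<in> T"
      define F where "F = real (card (R `` {y} \<inter> A))"
      have "F \<le> real (card (R `` {y} \<inter> (A \<union> T)))"
        unfolding F_def by (intro of_nat_mono card_mono) auto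
      then have "F < c * (a + J)" using y(2) cardAT by simp
      moreover have "c * (a - t) + c * (1 - c) \<le> (1 - c) * F"
        using small_degree_bound[OF c_pos _ c_bound D0 N M(1) ta] bigF[of y] yT T(1) c_less
        by (auto simp: F_def)
      moreover have "c * ((1 - c) * real J) \<le> c * (c * a - t + (1 - c))"
        using J'(2) c_pos by (intro mult_left_mono) auto
      ultimately have "(1 - c) * F < (1 - c) * F"
        using mult_strict_left_mono[of F "c * (a + J)" "1 - c"] c_less by (simp add: algebra_simps)
      then show False by simp
    qed
    then have yA: "y \<in> A" using y by blast
    have "card (R `` {y}) \<le> card ((R `` {y} \<inter> (A \<union> T)) \<union> (S - T))"
      using out_closed[OF yA] T S1 by (intro card_mono) auto
    also have "\<dots> \<le> card (R `` {y} \<inter> (A \<union> T)) + card (S - T)" by (rule card_Un_le)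
    also have "card (S - T) = card S - J" using T S1 by (subst card_Diff_subset) auto
    finally have "D \<le> real (card (R `` {y} \<inter> (A \<union> T))) + (k - J)"
      using out_degree[of y] yA subsets J(3) card_mono[OF finites(2) S1(1)]
      by (auto simp: D_def k_def of_nat_diff)
    then show False using y(2) cardAT J'(1) by (simp add: t_def algebra_simps)
  qed
  obtain y where y: "y \<in> A" "real (card (R `` {y} \<inter> A)) < c * a"
    using obtain_small_out_degree subsets ne by (metis a_def)
  define U where "U = R `` {y} \<inter> A"
  define Sy where "Sy = R `` {y} \<inter> S"
  have yV: "y \<in> V" using y subsets by auto
  have out_split: "D \<le> real (card (R `` {v} \<inter> A)) + real (card (R `` {v} \<inter> S))" if "v \<in> A" for v
  proof -
    have "card (R `` {v}) \<le> card ((R `` {v} \<inter> A) \<union> (R `` {v} \<inter> S))"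
      using out_closed[OF that] by (intro card_mono) auto
    also have "\<dots> \<le> card (R `` {v} \<inter> A) + card (R `` {v} \<inter> S)" by (rule card_Un_le)
    finally show ?thesis using out_degree[of v] that subsets by (auto simp: D_def)
  qed
  have out_A: "t \<le> real (card (R `` {v} \<inter> A))" if "v \<in> A" for v
  proof -
    have "card (R `` {v} \<inter> S) \<le> card S" by (intro card_mono) auto
    then show ?thesis using out_split[OF that] by (simp add: t_def k_def)
  qed
  have Sy_card: "D - card U \<le> real (card Sy)" using out_split[OF y(1)] by (simp add: U_def Sy_def)
  \<comment> \<open>|Sy| exceeds d - c a, while \<open>S1_small\<close> bounds (1 - c) |S1| by c a -
    t. The comparison uses a \<le> D + t / 2 and c (2 - c) \<le> 1 - c.\<close>
  have "real (card S1) < real (card Sy)"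
  proof -
    have "c * (2 - c) * (2 * a) \<le> c * (2 - c) * (2 * D + t)"
      using a2 M c_pos c_le_1 by (intro mult_left_mono) auto
    moreover have "c * (2 - c) * (2 * D) \<le> (1 - c) * (2 * D)"
      using c_bound D0 by (intro mult_right_mono) (auto simp: algebra_simps)
    moreover have "c * (2 - c) * t \<le> 1 * t"
      using c_bound t0 c_pos by (intro mult_right_mono) (auto simp: algebra_simps)
    ultimately have "c * (2 - c) * a \<le> (1 - c) * D + t" using t0 by (simp add: algebra_simps)
    then have "c * a - t \<le> (1 - c) * (D - c * a)" by (simp add: algebra_simps)
    also have "\<dots> \<le> (1 - c) * card Sy"
      using Sy_card y(2) c_le_1 by (intro mult_left_mono) (auto simp: U_def)
    finally have "(1 - c) * real (card S1) < (1 - c) * real (card Sy)" using S1_small by simp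
    then show ?thesis using c_less by simp
  qed
  then have "\<not> Sy \<subseteq> S1" using card_mono[OF S1(2), of Sy] by auto
  then have "Sy - S1 \<noteq> {}" by blast
  moreover have "Sy - S1 \<subseteq> V" using subsets by (auto simp: Sy_def)
  ultimately obtain z where z: "z \<in> Sy - S1"
    "real (card (R `` {z} \<inter> (Sy - S1))) < c * real (card (Sy - S1))"
    using obtain_small_out_degree by metis
  have zz: "z \<in> S" "(y, z) \<in> R" "R `` {z} \<inter> A = {}" using z(1) by (auto simp: Sy_def S1_def)
  \<comment> \<open>Thus z, chosen in Sy - S1, has few out-neighbours in all of Sy. An arc from z to
    z1 in S1 would keep N-(z) off N+(z1) in A and off N+(y) \<inter> N+(z) in S, so the in-degree of
    z would be too small.\<close>
  have no_S1: "R `` {z} \<inter> S1 = {}"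
  proof (rule ccontr)
    assume "R `` {z} \<inter> S1 \<noteq> {}"
    then obtain z1 where z1: "(z, z1) \<in> R" "z1 \<in> S1" by auto
    define F where "F = real (card (R `` {z1} \<inter> A))"
    define G where "G = real (card (R\<inverse> `` {z} \<inter> B))"
    have "card (R `` {z1} \<inter> A) + card (R\<inverse> `` {z} \<inter> A) \<le> card A"
      using no_triangle[OF z1(1)] by (intro card_disjoint2_le) auto
    moreover have "card (R\<inverse> `` {z} \<inter> S) + card (R `` {z} \<inter> S) + card {z} \<le> card S"
      using irrefl[of z] zz(1) by (intro card_disjoint3_le) (auto dest: asym)
    moreover have "card (R\<inverse> `` {z}) \<le>
        card (R\<inverse> `` {z} \<inter> A) + (card (R\<inverse> `` {z} \<inter> S) + (card (R\<inverse> `` {z} \<inter> B) + card {x}))"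
    proof -
      have "R\<inverse> `` {z} \<subseteq> (R\<inverse> `` {z} \<inter> A) \<union> ((R\<inverse> `` {z} \<inter> S) \<union> ((R\<inverse> `` {z} \<inter> B) \<union> {x}))"
        using in_subset[of "{z}"] V_eq by auto
      then have "card (R\<inverse> `` {z}) \<le> card ((R\<inverse> `` {z} \<inter> A) \<union> ((R\<inverse> `` {z} \<inter> S) \<union> ((R\<inverse> `` {z} \<inter> B) \<union> {x})))"
        by (intro card_mono) auto
      then show ?thesis by (meson card_Un_le add_left_mono order_trans)
    qed
    moreover have "d \<le> card (R\<inverse> `` {z})" using in_degree zz subsets by auto
    moreover have "card (R `` {y} \<inter> R `` {z}) \<le> card (R `` {z} \<inter> S)"
      using out_closed[OF y(1)] zz(3) by (intro card_mono) auto
    ultimately have "F + t - G + card (R `` {y} \<inter> R `` {z}) \<le> a"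
      by (simp add: F_def G_def t_def D_def k_def a_def)
    then have "c * (F + t - G + card (R `` {y} \<inter> R `` {z})) \<le> c * a"
      using c_pos by (intro mult_left_mono) auto
    then have over: "c * (F + t - G) + e \<le> c * a"
      using common_out_neighbours[OF zz(2)] by (simp add: algebra_simps e_def)
    have F: "e + (1 - c) * t - c * D + c * a < c * (2 - c) * F" using bigF[OF z1(2)] by (simp add: F_def)
    show False
    proof (cases "G = 0")
      case True
      then show False using over neighbourhood_overflow[OF c3 c_less D0 N M(1) a2 F] by simp
    next
      case False
      then have "R\<inverse> `` {z} \<inter> B \<noteq> {}" by (auto simp: G_def)
      then have "D + t - b + (1 - c) * G < 0"
        using conv.return_arcs[OF zz(1)] zz(3) by (simp add: G_def t_def D_def k_def b_def)
      then have "(1 - c) * G < D - a - e" using ab by simp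
      from neighbourhood_overflow_backward[OF c3 c_less D0 W M(2) ta F this] over show False by simp
    qed
  qed
  have "U \<noteq> {}" using out_A[OF y(1)] t0 by (auto simp: U_def)
  then obtain w where w: "w \<in> U" "real (card (R `` {w} \<inter> U)) < c * real (card U)"
    using obtain_small_out_degree[of U] subsets by (auto simp: U_def)
  have wA: "w \<in> A" "(y, w) \<in> R" using w by (auto simp: U_def)
  \<comment> \<open>Both the out-neighbours of y in A and those of w in A avoid N-(y), since (y, w)
    is an arc. This gives the lower bound \<open>tau\<close> on the part of A outside N-(y).\<close>
  have "card {y} + card U + card (R `` {w} \<inter> A - U) \<le> card (A - R\<inverse> `` {y})"
    using y(1) wA irrefl[of y] no_triangle[OF wA(2)]
    by (intro card_disjoint3_le) (auto simp: U_def dest: asym)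
  moreover have "card (R `` {w} \<inter> A) = card (R `` {w} \<inter> U) + card (R `` {w} \<inter> A - U)"
    using card_Int_Diff[of "R `` {w} \<inter> A" U] by (simp add: U_def Int_assoc Int_left_commute Int_commute)
  ultimately have tau: "1 + card U + t - c * card U < real (card (A - R\<inverse> `` {y}))"
    using out_A[OF wA(1)] w(2) by simp
  have "card (R\<inverse> `` {y}) + card (R `` {z}) + card (Sy - R `` {z}) + card (A - R\<inverse> `` {y}) \<le> card V"
    using in_subset[of "{y}"] out_subset[of "{z}"] subsets zz(3) no_triangle[OF zz(2)] disjoint finite_V
    by (intro card_disjoint4_le) (auto simp: Sy_def dest: asym)
  moreover have "d \<le> card (R\<inverse> `` {y})" "d \<le> card (R `` {z})"
    using in_degree[OF yV] out_degree[of z] zz subsets by auto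
  moreover have "(1 - c) * card Sy \<le> real (card (Sy - R `` {z}))"
  proof -
    have "R `` {z} \<inter> Sy = R `` {z} \<inter> (Sy - S1)" using no_S1 by auto
    then have "real (card (R `` {z} \<inter> Sy)) < c * real (card (Sy - S1))" using z(2) by simp
    also have "\<dots> \<le> c * card Sy" using c_pos by (intro mult_left_mono of_nat_mono card_mono) (auto simp: Sy_def)
    finally show ?thesis
      using card_Int_Diff[of Sy "R `` {z}"] by (simp add: Sy_def Int_commute algebra_simps)
  qed
  moreover have "(1 - c) * (D - card U) \<le> (1 - c) * card Sy"
    using Sy_card c_le_1 by (intro mult_left_mono) auto
  \<comment> \<open>The terms with |U| cancel, leaving n > (3 - c) D + 1 + t, that is t + e < c D,
    against \<open>te\<close>.\<close>
  ultimately have "2 * D + (1 - c) * (D - card U) + (1 + card U + t - c * card U) < real (card V)"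
    using tau by (simp add: D_def)
  then show False using te by (simp add: e_def D_def algebra_simps)
qed

end

section \<open>Cycles through a vertex\<close>

lemma card_eq_sum_out_degree:
  assumes "finite V" "R \<subseteq> V \<times> V"
  shows "card R = (\<Sum>v\<in>V. card (R `` {v}))"
proof -
  have "R = Sigma V (\<lambda>v. R `` {v})" using assms(2) by auto
  moreover have "finite (R `` {v})" for v using assms by (meson finite_Image finite_SigmaI finite_subset)
  ultimately show ?thesis using card_SigmaI[OF assms(1), of "\<lambda>v. R `` {v}"] by metis
qed

lemma short_cycle_const_le_1: "short_cycle_const \<le> 1"
  by (rule short_cycle_const_minimum(2)[OF forces_short_cycle_1])

text \<open>The argument of Caccetta and Haeggkvist: a vertex v of large in-degree and a vertex y of small
  out-degree in the out-neighbourhood of v.\<close>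

lemma short_cycle_const_bound: "short_cycle_const * (3 - short_cycle_const) \<le> 1"
proof (rule ccontr)
  define c where "c = short_cycle_const"
  have c1: "c \<le> 1" using short_cycle_const_le_1 by (simp add: c_def)
  have forces: "forces_short_cycle c" using short_cycle_const_minimum(1) by (simp add: c_def)
  assume "\<not> short_cycle_const * (3 - short_cycle_const) \<le> 1"
  then have "1 / (3 - c) < c" using c1 by (simp add: c_def field_simps)
  \<comment> \<open>By minimality of c there is a digraph without short cycles and with out-degrees
    at least n / (3 - c).\<close>
  then have "\<not> forces_short_cycle (1 / (3 - c))"
    using short_cycle_const_minimum(2)[of "1 / (3 - c)"] by (auto simp: c_def)
  then obtain V :: "nat set" and R k where V: "finite V" "V \<noteq> {}" "R \<subseteq> V \<times> V"
    "\<not> rel_short_cycle R" "1 / (3 - c) * real (card V) \<le> real k" "\<And>v. v \<in> V \<Longrightarrow> k \<le> card (R `` {v})"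
    by (rule not_forces_short_cycleE) blast
  have n: "real (card V) \<le> (3 - c) * real k" using V(5) c1 by (simp add: field_simps)
  moreover have "card V > 0" using V by (simp add: card_gt_0_iff)
  ultimately have k: "k > 0" by (cases k) auto
  have fin: "finite (R `` {u})" "finite (R\<inverse> `` {u})" for u
    using V(1,3) by (auto intro: finite_subset[of _ V])
  \<comment> \<open>Averaging: in-degrees and out-degrees have the same sum.\<close>
  have "\<exists>v\<in>V. k \<le> card (R\<inverse> `` {v})"
  proof (rule ccontr)
    assume "\<not> ?thesis"
    then have "(\<Sum>v\<in>V. card (R\<inverse> `` {v})) < (\<Sum>v\<in>V. k)"
      using V(1,2) by (intro sum_strict_mono) auto
    also have "\<dots> \<le> (\<Sum>v\<in>V. card (R `` {v}))" using V(6) by (intro sum_mono)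
    also have "\<dots> = card (R\<inverse>)" using card_eq_sum_out_degree[OF V(1,3)] by simp
    also have "\<dots> = (\<Sum>v\<in>V. card (R\<inverse> `` {v}))"
      using V(3) by (intro card_eq_sum_out_degree[OF V(1)]) auto
    finally show False by simp
  qed
  then obtain v where v: "v \<in> V" "k \<le> card (R\<inverse> `` {v})" by blast
  have "R `` {v} \<noteq> {}" using V(6)[OF v(1)] k by auto
  then obtain y where y: "(v, y) \<in> R" "real (card (R `` {y} \<inter> R `` {v})) < c * real (card (R `` {v}))"
    using exists_small_out_degree[OF forces fin(1) V(4)] by blast
  have "R\<inverse> `` {v} \<inter> R `` {v} = {}" "R\<inverse> `` {v} \<inter> R `` {y} = {}"
    using V(4) y(1) unfolding rel_short_cycle_def by blast+
  then have "card (R\<inverse> `` {v}) + card (R `` {v}) + card (R `` {y} - R `` {v}) \<le> card V"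
    using V(1,3) by (intro card_disjoint3_le) auto
  moreover have "card (R `` {y}) = card (R `` {y} \<inter> R `` {v}) + card (R `` {y} - R `` {v})"
    by (rule card_Int_Diff[OF fin(1)])
  moreover have "k \<le> card (R `` {y})" using V(3,6) y(1) by auto
  moreover have "(1 - c) * real k \<le> (1 - c) * real (card (R `` {v}))"
    using V(6)[OF v(1)] c1 by (intro mult_left_mono) auto
  ultimately have "(3 - c) * real k < real (card V)" using v(2) y(2) by (simp add: algebra_simps)
  then show False using n by simp
qed

lemma successively_set_subset:
  assumes "successively (\<lambda>u v. (u, v) \<in> R) p" "p \<noteq> []" "hd p \<in> W" "R \<subseteq> UNIV \<times> W"
  shows "set p \<subseteq> W"
  using assms
proof (induction p)
  case (Cons a p)
  then show ?case by (cases p) auto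
qed simp

section \<open>Lower bound for separators in D - x\<close>

context short_cycle_free
begin

text \<open>A separator T that is too small yields a separation to which
  \<open>cut_contradiction\<close> applies, either directly or after reversal, according to which of
  A and B is smaller. The vertex v of degree exactly d bounds \<open>slack\<close> from
  above.\<close>

lemma separator_large:
  assumes x: "x \<in> V" and d: "d \<ge> 1" and n: "card V \<le> 3 * d"
    and tight: "v \<in> V" "card (R `` {v}) = d \<or> card (R\<inverse> `` {v}) = d"
    and T: "finite T" "separates (R \<inter> (V - {x}) \<times> (V - {x})) (R `` {x}) (R\<inverse> `` {x}) T"
  shows "(1 - c) * (2 - c) * (real d - real (card T) + slack) < 2 * (c * real d + 1 - slack)"
proof (rule ccontr)
  assume neg_T: "\<not> ?thesis"
  define V' where "V' = V - {x}"
  define R' where "R' = R \<inter> V' \<times> V'"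
  \<comment> \<open>T may contain vertices outside D - x. Dropping them only strengthens the negated
    bound. A consists of the vertices that x still reaches without meeting T.\<close>
  define S where "S = T \<inter> V'"
  define A where "A = {u \<in> V' - S. \<exists>p. walk_between R' (R `` {x}) {u} p \<and> set p \<inter> T = {}}"
  define B where "B = V' - S - A"
  have slack: "0 \<le> slack" "slack < c\<^sup>2 * real d" using n slack_less_semi[OF tight d] by linarith+
  have "card S \<le> card T" using T(1) by (auto simp: S_def intro: card_mono)
  then have "(1 - c) * (2 - c) * (real d - real (card T) + slack)
      \<le> (1 - c) * (2 - c) * (real d - real (card S) + slack)"
    using c_le_1 by (intro mult_left_mono) auto
  then have neg: "2 * (c * real d + 1 - slack) \<le> (1 - c) * (2 - c) * (real d - real (card S) + slack)"
    using neg_T by linarith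
  have Sd: "card S < d"
    using slack_weighted_consequences(2)[OF c_pos _ _ neg slack(2)] c_less by simp
  \<comment> \<open>Applied to the whole of V, the choice of c gives d < c n \<le> 3 c d.\<close>
  obtain u where "u \<in> V" "real (card (R `` {u} \<inter> V)) < c * real (card V)"
    using obtain_small_out_degree[of V] x by auto
  moreover have "R `` {u} \<inter> V = R `` {u}" using out_subset by blast
  moreover have "c * real (card V) \<le> c * (3 * real d)"
    using n c_pos by (intro mult_left_mono) linarith+
  ultimately have "real d < c * (3 * real d)" using out_degree[of u] by simp
  then have c3: "1 / 3 < c" using d by (simp add: field_simps)
  have nx: "R `` {x} \<subseteq> V'" "R\<inverse> `` {x} \<subseteq> V'"
    using out_subset[of "{x}"] in_subset[of "{x}"] irrefl by (auto simp: V'_def)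
  have start: "u \<in> A" if "(x, u) \<in> R" "u \<notin> S" for u
  proof -
    have "u \<in> V'" using nx(1) that(1) by auto
    moreover from this have "walk_between R' (R `` {x}) {u} [u] \<and> set [u] \<inter> T = {}"
      using that by (auto simp: walk_between_def S_def)
    ultimately show ?thesis using that(2) unfolding A_def by blast
  qed
  have step: "u' \<in> A" if u: "u \<in> A" "(u, u') \<in> R" "u' \<noteq> x" "u' \<notin> S" for u u'
  proof -
    from u(1) obtain p where p: "walk_between R' (R `` {x}) {u} p" "set p \<inter> T = {}" "u \<in> V'"
      unfolding A_def by blast
    have u': "u' \<in> V'" "u' \<notin> T" using u R_subset by (auto simp: V'_def S_def)
    have "walk_between R' (R `` {x}) {u'} (p @ [u'])"
      using p(1,3) u(2) u'(1) by (auto simp: walk_between_def successively_append_iff R'_def)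
    moreover have "set (p @ [u']) \<inter> T = {}" using p(2) u' by simp
    ultimately show ?thesis using u'(1) u(4) unfolding A_def by blast
  qed
  have no_B: "(u, x) \<notin> R" if "u \<in> A" for u
  proof
    assume ux: "(u, x) \<in> R"
    from that obtain p where p: "walk_between R' (R `` {x}) {u} p" "set p \<inter> T = {}"
      unfolding A_def by blast
    then have "walk_between R' (R `` {x}) (R\<inverse> `` {x}) p" using ux by (auto simp: walk_between_def)
    then show False using T(2) p(2) unfolding separates_def R'_def V'_def by blast
  qed
  have sub: "A \<subseteq> V'" "S \<subseteq> V'" "A \<inter> S = {}" by (auto simp: A_def S_def)
  interpret sep: separation V R d c x A S B
  proof unfold_locales
    show "V = insert x (A \<union> S \<union> B)" using x sub by (auto simp: B_def V'_def)
    show "x \<notin> A" "x \<notin> S" "x \<notin> B" using sub by (auto simp: B_def V'_def)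
    show "A \<inter> S = {}" "A \<inter> B = {}" "S \<inter> B = {}" using sub by (auto simp: B_def)
    show "R `` {y} \<subseteq> A \<union> S" if "y \<in> A" for y
      using step[OF that] no_B[OF that] by auto
    show "R\<inverse> `` {y} \<subseteq> B \<union> S" if "y \<in> B" for y
    proof
      fix u assume "u \<in> R\<inverse> `` {y}"
      then have uy: "(u, y) \<in> R" by simp
      have y: "y \<notin> A" "y \<notin> S" "y \<noteq> x" using that by (auto simp: B_def V'_def)
      have "u \<noteq> x" using start y uy by blast
      moreover have "u \<notin> A" using step[OF _ uy] y by blast
      ultimately show "u \<in> B \<union> S" using uy R_subset by (auto simp: B_def V'_def)
    qed
  qed
  have "R `` {x} \<subseteq> A \<union> S" using start by blast
  moreover have "R\<inverse> `` {x} \<subseteq> B \<union> S" using no_B nx(2) by (auto simp: B_def)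
  moreover have "\<not> R `` {x} \<subseteq> S" "\<not> R\<inverse> `` {x} \<subseteq> S"
    using card_mono[OF sep.finites(2), of "R `` {x}"] card_mono[OF sep.finites(2), of "R\<inverse> `` {x}"]
      out_degree[OF x] in_degree[OF x] Sd by linarith+
  ultimately have ne: "A \<noteq> {}" "B \<noteq> {}" by blast+
  interpret conv: separation V "R\<inverse>" d c x B S A by (rule sep.converse_separation)
  show False
    using sep.cut_contradiction[OF ne _ c3 slack neg] conv.cut_contradiction[OF ne(2,1) _ c3 slack neg]
    by linarith
qed

end

section \<open>From paths between neighbourhoods to directed cycles\<close>

lemma (in wf_digraph) awalk_of_vertex_list:
  assumes "successively (\<lambda>u v. u \<rightarrow>\<^bsub>G\<^esub> v) (v # vs)" "v \<in> verts G"
  shows "\<exists>p. awalk v p (last (v # vs)) \<and> awalk_verts v p = v # vs"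
  using assms
proof (induction vs arbitrary: v)
  case Nil
  then show ?case by (intro exI[of _ "[]"]) (simp add: awalk_Nil_iff)
next
  case (Cons w vs)
  then have vw: "v \<rightarrow>\<^bsub>G\<^esub> w" by simp
  then obtain e where e: "e \<in> arcs G" "tail G e = v" "head G e = w" by (rule reachableE)
  have "w \<in> verts G" using e by auto
  then obtain p where "awalk w p (last (w # vs))" "awalk_verts w p = w # vs"
    using Cons by auto
  then show ?case using e by (intro exI[of _ "e # p"]) (simp add: awalk_Cons_iff)
qed

text \<open>The list x # p @ [x] is a closed walk, and the tails of its arcs are exactly the entries
  of x # p.\<close>

lemma (in wf_digraph) cycle_through:
  assumes "walk_between (arcs_ends G) (arcs_ends G `` {x}) ((arcs_ends G)\<inverse> `` {x}) p"
    and "distinct p" "x \<notin> set p" "x \<in> verts G"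
  shows "\<exists>q. cycle q \<and> cycle_verts G q = insert x (set p)"
proof -
  have "successively (\<lambda>u v. u \<rightarrow>\<^bsub>G\<^esub> v) (x # p @ [x])"
    using assms(1) by (auto simp: walk_between_def successively_Cons successively_append_iff hd_append)
  then obtain q where q: "awalk x q x" "awalk_verts x q = x # p @ [x]"
    using awalk_of_vertex_list[of x "p @ [x]"] assms(4) by auto
  have "q \<noteq> []" using q(2) by auto
  then have "map (tail G) q @ [head G (last q)] = (x # p) @ [x]"
    using q(2) by (simp add: awalk_verts_conv)
  then have "map (tail G) q = x # p" by (simp only: append1_eq_conv)
  from arg_cong[OF this, of set] have "cycle_verts G q = insert x (set p)"
    by (simp add: cycle_verts_def)
  moreover have "cycle q" using q \<open>q \<noteq> []\<close> assms(2,3) by (auto simp: cycle_def intro!: exI[of _ x])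
  ultimately show ?thesis by blast
qed

lemma (in digraph) card_arcs_ends_Image: "card (arcs_ends G `` {v}) = out_degree G v"
  and card_arcs_ends_converse_Image: "card ((arcs_ends G)\<inverse> `` {v}) = in_degree G v"
proof -
  have "arcs_ends G `` {v} = head G ` out_arcs G v" "(arcs_ends G)\<inverse> `` {v} = tail G ` in_arcs G v"
    by (auto simp: arcs_ends_conv)
  moreover have "inj_on (head G) (out_arcs G v)" "inj_on (tail G) (in_arcs G v)"
    by (rule inj_onI, rule no_multi_arcs, simp_all add: arc_to_ends_def)+
  ultimately show "card (arcs_ends G `` {v}) = out_degree G v"
    "card ((arcs_ends G)\<inverse> `` {v}) = in_degree G v"
    by (simp_all add: out_degree_def in_degree_def card_image)
qed

lemma (in oriented_graph) not_rel_short_cycle: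
  assumes "\<not> has_directed_triangle G"
  shows "\<not> rel_short_cycle (arcs_ends G)"
proof
  assume "rel_short_cycle (arcs_ends G)"
  then obtain p where p: "cycle p" "length p \<le> 3" using rel_imp_short_cycle by blast
  then have "length p \<le> 2" using assms by (fastforce simp: has_directed_triangle_def)
  obtain u where u: "awalk u p u" "p \<noteq> []" using p(1) by (auto simp: cycle_def)
  then consider e where "p = [e]" | e f where "p = [e, f]"
    using \<open>length p \<le> 2\<close> by (cases p; cases "tl p"; auto)
  then show False
  proof cases
    case 1
    then show False using u(1) no_loops[of e] by (auto simp: awalk_simps)
  next
    case 2
    then have "e \<in> arcs G" "f \<in> arcs G" "tail G f = head G e" "head G f = tail G e"
      using u(1) by (auto simp: awalk_simps)
    then have "tail G e \<rightarrow>\<^bsub>G\<^esub> head G e" "head G e \<rightarrow>\<^bsub>G\<^esub> tail G e" "tail G e \<noteq> head G e"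
      using no_loops by (metis in_arcs_imp_in_arcs_ends)+
    then show False using at_most_one_arc adj_in_verts by blast
  qed
qed

theorem theorem1p5:
  fixes D :: "('a, 'b) pre_digraph" and d :: nat and m :: real and x :: 'a
  defines "c \<equiv> short_cycle_const"
  assumes "d \<ge> 1"
    and "oriented_graph D"
    and "\<not> has_directed_triangle D"
    and "min_semi_degree D = d"
    and "real (card (verts D)) = m * real d"
    and "m \<le> 3"
    and "x \<in> verts D"
  shows "\<exists>C. finite C
    \<and> (\<forall>p\<in>C. pre_digraph.cycle D p \<and> x \<in> cycle_verts D p)
    \<and> (\<forall>p\<in>C. \<forall>q\<in>C. p \<noteq> q \<longrightarrow> cycle_verts D p \<inter> cycle_verts D q = {x})
    \<and> real (card C) > 2 * (5 - m - 4 * c + c\<^sup>2) * real d / ((1 - c) * (2 - c)) + (2 - m) * real d + 1"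
proof -
  interpret D: oriented_graph D by (rule assms(3))
  define V where "V = verts D"
  define R where "R = arcs_ends D"
  have deg: "d \<le> card (R `` {v})" "d \<le> card (R\<inverse> `` {v})" if "v \<in> V" for v
  proof -
    have "min_out_degree D \<le> out_degree D v" "min_in_degree D \<le> in_degree D v"
      using that unfolding min_out_degree_def min_in_degree_def V_def by (auto intro!: Min_le)
    then show "d \<le> card (R `` {v})" "d \<le> card (R\<inverse> `` {v})"
      using assms(5) by (auto simp: R_def D.card_arcs_ends_Image D.card_arcs_ends_converse_Image
          min_semi_degree_def)
  qed
  interpret short_cycle_free V R d c
  proof
    show "finite V" "R \<subseteq> V \<times> V" by (auto simp: V_def R_def arcs_ends_conv)
    show "\<not> rel_short_cycle R" unfolding R_def by (rule D.not_rel_short_cycle[OF assms(4)])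
    show "forces_short_cycle c" "c \<le> 1" "c * (3 - c) \<le> 1"
      unfolding c_def by (rule short_cycle_const_minimum short_cycle_const_le_1 short_cycle_const_bound)+
  qed (use deg in auto)
  have xV: "x \<in> V" using assms(8) by (simp add: V_def)
  \<comment> \<open>The minimum semi-degree is attained, as an out-degree or as an
    in-degree.\<close>
  have "min_out_degree D \<in> out_degree D ` V" "min_in_degree D \<in> in_degree D ` V"
    unfolding min_out_degree_def min_in_degree_def V_def using assms(8) by (auto intro!: Min_in)
  then have "\<exists>v\<in>V. card (R `` {v}) = d \<or> card (R\<inverse> `` {v}) = d"
    using assms(5) by (auto simp: R_def D.card_arcs_ends_Image D.card_arcs_ends_converse_Image
        min_semi_degree_def min_def split: if_splits)
  then obtain v where v: "v \<in> V" "card (R `` {v}) = d \<or> card (R\<inverse> `` {v}) = d" by blast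
  have cardV: "real (card V) = m * real d" using assms(6) by (simp add: V_def)
  have "m * real d \<le> 3 * real d" using assms(7) by (intro mult_right_mono) auto
  then have n: "card V \<le> 3 * d" using cardV by linarith
  define X where "X = 2 * (5 - m - 4 * c + c\<^sup>2) * real d / ((1 - c) * (2 - c)) + (2 - m) * real d + 1"
  define R' where "R' = R \<inter> (V - {x}) \<times> (V - {x})"
  \<comment> \<open>The least natural number above X; for negative X the truncation gives 0.\<close>
  define s where "s = nat (\<lfloor>X\<rfloor> + 1)"
  have X_less: "X < real (card T)" if T: "finite T" "separates R' (R `` {x}) (R\<inverse> `` {x}) T" for T
  proof -
    define q where "q = (1 - c) * (2 - c)"
    have q: "0 < q" using c_less by (simp add: q_def)
    have "q * (real d - real (card T) + slack) < 2 * (c * real d + 1 - slack)"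
      using separator_large[OF xV assms(2) n v T[unfolded R'_def]] by (simp add: q_def)
    moreover have "q * X = 2 * (5 - m - 4 * c + c\<^sup>2) * real d + q * ((2 - m) * real d + 1)"
      using q by (simp add: X_def q_def[symmetric] field_simps)
    \<comment> \<open>With slack = (3 - m) d + 1, solving \<open>separator_large\<close> for q |T|
      gives exactly q X as the lower bound; 2 q d = (4 - 6 c + 2 c^2) d supplies the terms in
      c.\<close>
    ultimately have "q * X < q * real (card T)"
      unfolding cardV q_def by (simp add: algebra_simps power2_eq_square)
    then show ?thesis using q by simp
  qed
  have "\<exists>P. disjoint_paths R' (R `` {x}) (R\<inverse> `` {x}) P \<and> finite P \<and> card P = s"
  proof (rule menger)
    show "finite R'" using R_subset finite_V unfolding R'_def by (auto intro: finite_subset)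
    show "finite (R `` {x})" by simp
    fix T assume "finite T" "separates R' (R `` {x}) (R\<inverse> `` {x}) T"
    then have "X < real (card T)" by (rule X_less)
    then show "s \<le> card T" unfolding s_def by linarith
  qed
  then obtain P where P: "disjoint_paths R' (R `` {x}) (R\<inverse> `` {x}) P" "finite P" "card P = s" by blast
  have path: "walk_between R (R `` {x}) (R\<inverse> `` {x}) p" "distinct p" "x \<notin> set p" "p \<noteq> []"
    if "p \<in> P" for p
  proof -
    have w: "walk_between R' (R `` {x}) (R\<inverse> `` {x}) p" and dist: "distinct p"
      using P(1) that by (auto simp: disjoint_paths_def)
    show "walk_between R (R `` {x}) (R\<inverse> `` {x}) p"
      using walk_between_mono[OF w] by (auto simp: R'_def)
    show "distinct p" by (rule dist)
    show "p \<noteq> []" using w by (simp add: walk_between_def)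
    have "set p \<subseteq> - {x}"
      using w irrefl by (intro successively_set_subset[of R']) (auto simp: walk_between_def R'_def)
    then show "x \<notin> set p" by auto
  qed
  have "\<forall>p\<in>P. \<exists>q. D.cycle q \<and> cycle_verts D q = insert x (set p)"
    using path D.cycle_through assms(8) unfolding R_def by simp
  then obtain f where f: "\<And>p. p \<in> P \<Longrightarrow> D.cycle (f p) \<and> cycle_verts D (f p) = insert x (set p)"
    by metis
  have disj: "set p \<inter> set p' = {}" if "p \<in> P" "p' \<in> P" "p \<noteq> p'" for p p'
    using P(1) that by (auto simp: disjoint_paths_def pairwise_def)
  \<comment> \<open>The paths are non-empty and avoid x, so disjoint paths give cycles with
    different vertex sets.\<close>
  have "inj_on f P"
  proof (rule inj_onI, rule ccontr)
    fix p p' assume p: "p \<in> P" "p' \<in> P" "f p = f p'" "p \<noteq> p'"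
    then have "insert x (set p) = insert x (set p')" using f by metis
    then have "set p = set p'" using path(3)[OF p(1)] path(3)[OF p(2)] by (metis insert_ident)
    then show False using disj[OF p(1,2,4)] path(4)[OF p(1)] by simp
  qed
  then have "card (f ` P) = s" using P(3) by (simp add: card_image)
  moreover have "X < real s" unfolding s_def by linarith
  moreover have "cycle_verts D q \<inter> cycle_verts D q' = {x}" if "q \<in> f ` P" "q' \<in> f ` P" "q \<noteq> q'" for q q'
  proof -
    from that obtain p p' where "p \<in> P" "p' \<in> P" "p \<noteq> p'" "q = f p" "q' = f p'" by blast
    then show ?thesis using f disj by auto
  qed
  ultimately show ?thesis
    using P(2) f unfolding X_def[symmetric] by (intro exI[of _ "f ` P"]) auto
qed

end
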